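(* Let $\Theta_{\kappa_0}$ be an L-system (with one-dimensional input-output space $\mathbb C$ and $J=1$), with symmetric operator $\dot A$, such that its impedance function $V_{\Theta_{\kappa_0}}(z)$ belongs to the class $\mathfrak M_{\kappa_0}$. Then for any real number $Q\neq0$ there exists another L-system $\Theta^Q_\kappa$ with the same symmetric operator $\dot A$ as in $\Theta_{\kappa_0}$ and such that $$V_{\Theta^Q_\kappa}(z)=Q+V_{\Theta_{\kappa_0}}(z).$$ Moreover, with $a=\frac{1-\kappa_0}{1+\kappa_0}$ and $b=Q^2+a^2-1$, the von Neumann parameter $\kappa=\kappa(Q)$ of its main operator $T^Q$ is $$\kappa=\frac{\left(b-2Q^2-\sqrt{b^2+4Q^2}\right)^2-a\left(b-\sqrt{b^2+4Q^2}\right)^2+4Q^2a(a-1)}{\left(b-2Q^2-\sqrt{b^2+4Q^2}\right)^2+a\left(b-\sqrt{b^2+4Q^2}\right)^2+4Q^2a(a+1)},$$ while the quasi-kernel $\hat A^Q$ of $\mathrm{Re}\,\mathbb A^Q$ of the L-system $\Theta^Q_\kappa$ has von Neumann parameter $$U=\frac{(a+Qi)(1-\kappa^2)-1-\kappa^2}{2\kappa}.$$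
   Context: Class $\mathfrak M_{\kappa_0}$ ($0\le\kappa_0<1$): functions $M(z)=\int_{\mathbb R}\left(\frac{1}{\lambda-z}-\frac{\lambda}{1+\lambda^2}\right)d\mu(\lambda)$ with $\mu$ an infinite Borel measure and $\int_{\mathbb R}\frac{d\mu(\lambda)}{1+\lambda^2}=\frac{1-\kappa_0}{1+\kappa_0}$. Rigged space: for a closed densely defined prime symmetric operator $\dot A$ with deficiency indices $(1,1)$ in a complex Hilbert space $\mathcal H$, let $\mathcal H_+=\mathrm{Dom}(\dot A^* )$ with $(f,g)_+=(f,g)+(\dot A^*f,\dot A^*g)$, and let $\mathcal H_+\subset\mathcal H\subset\mathcal H_-$ be the associated rigged Hilbert space. $[X,Y]$ denotes bounded linear operators. If $\mathbb A\in[\mathcal H_+,\mathcal H_-]$ then $\mathbb A^*\in[\mathcal H_+,\mathcal H_-]$; $\mathrm{Re}\,\mathbb A=(\mathbb A+\mathbb A^* )/2$, $\mathrm{Im}\,\mathbb A=(\mathbb A-\mathbb A^* )/2i$. The quasi-kernel $\hat A$ of $\mathrm{Re}\,\mathbb A$ is its restriction to $\{f\in\mathcal H_+:\mathrm{Re}\,\mathbb A f\in\mathcal H\}$. L-system: let $T$ be a non-symmetric operator with $\dot A\subset T\subset\dot A^*$, $\rho(T)\ne\emptyset$, $\mathrm{Dom}(\dot A)=\mathrm{Dom}(T)\cap\mathrm{Dom}(T^* )$. A $( * )$-extension of $T$ is $\mathbb A\in[\mathcal H_+,\mathcal H_-]$ with $\dot A\subset T\subset\mathbb A$, $\dot A\subset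 T^*\subset\mathbb A^*$ such that the quasi-kernel $\hat A$ of $\mathrm{Re}\,\mathbb A$ is self-adjoint in $\mathcal H$. An L-system is $\Theta=\begin{pmatrix}\mathbb A&K&1\\ \mathcal H_+\subset\mathcal H\subset\mathcal H_-&&\mathbb C\end{pmatrix}$ where $\mathbb A$ is a $( * )$-extension of such a $T$ (main operator), $K\in[\mathbb C,\mathcal H_-]$, $\mathrm{Im}\,\mathbb A=KK^*$, $\mathrm{Ran}(K)=\mathrm{Ran}(\mathrm{Im}\,\mathbb A)$. Impedance function: $V_\Theta(z)=K^*(\mathrm{Re}\,\mathbb A-zI)^{-1}K$, $z\in\rho(\hat A)$. Parameters: for normalized $g_\pm\in\mathrm{Ker}(\dot A^*\mp iI)$, the von Neumann parameter $\kappa$ of $T$ is defined by $g_+-\kappa g_-\in\mathrm{Dom}(T)$, $|\kappa|<1$; $g_\pm$ are chosen (changing the phase of $g_-$) so that $0\le\kappa<1$. The parameter $U$ ($|U|=1$) of $\hat A$ is defined, with respect to the same pair, by $g_++Ug_-\in\mathrm{Dom}(\hat A)$. *)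

theory Defs
  imports "HOL-Analysis.Analysis"
begin

section \<open>Complex Hilbert spaces\<close>

(* The inner product is linear in the first and antilinear in the second argument. Positive
   definiteness is a consequence of the last axiom and of the norm axioms inherited from banach. *)
class complex_hilbert = banach +
  fixes scaleC :: "complex \<Rightarrow> 'a \<Rightarrow> 'a" (infixr "*\<^sub>C" 75)
    and cinner :: "'a \<Rightarrow> 'a \<Rightarrow> complex"
  assumes scaleR_scaleC: "r *\<^sub>R x = complex_of_real r *\<^sub>C x"
    and scaleC_add_right: "c *\<^sub>C (x + y) = c *\<^sub>C x + c *\<^sub>C y"
    and scaleC_add_left: "(c + d) *\<^sub>C x = c *\<^sub>C x + d *\<^sub>C x"
    and scaleC_scaleC: "c *\<^sub>C (d *\<^sub>C x) = (c * d) *\<^sub>C x"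
    and scaleC_one: "1 *\<^sub>C x = x"
    and cinner_commute: "cinner x y = cnj (cinner y x)"
    and cinner_add_left: "cinner (x + y) z = cinner x z + cinner y z"
    and cinner_scaleC_left: "cinner (c *\<^sub>C x) y = c * cinner x y"
    and norm_eq_sqrt_cinner: "norm x = sqrt (Re (cinner x x))"

global_interpretation complex_vector:
  vector_space "scaleC :: complex \<Rightarrow> 'a \<Rightarrow> 'a::complex_hilbert"
  by unfold_locales (simp_all add: scaleC_add_right scaleC_add_left scaleC_scaleC scaleC_one)

instantiation complex :: complex_hilbert
begin

definition "scaleC_complex (c :: complex) (x :: complex) = c * x"
definition "cinner_complex (x :: complex) (y :: complex) = x * cnj y"

instance
  by standard
    (simp_all add: scaleC_complex_def cinner_complex_def scaleR_conv_of_real algebra_simps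
      cmod_def power2_eq_square)

end


section \<open>Unbounded operators\<close>

(* An operator is identified with its graph, so that Domain A is its domain and
   extension of operators is inclusion of sets. *)
type_synonym 'h operator = "('h \<times> 'h) set"

definition linear_operator :: "'h::complex_hilbert operator \<Rightarrow> bool" where
  "linear_operator A \<longleftrightarrow> single_valued A \<and> (0, 0) \<in> A
     \<and> (\<forall>x y x' y'. (x, y) \<in> A \<longrightarrow> (x', y') \<in> A \<longrightarrow> (x + x', y + y') \<in> A)
     \<and> (\<forall>c x y. (x, y) \<in> A \<longrightarrow> (c *\<^sub>C x, c *\<^sub>C y) \<in> A)"

definition op_app :: "'h operator \<Rightarrow> 'h \<Rightarrow> 'h" where
  "op_app A x = (THE y. (x, y) \<in> A)"

definition densely_defined :: "'h::complex_hilbert operator \<Rightarrow> bool" where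
  "densely_defined A \<longleftrightarrow> closure (Domain A) = UNIV"

definition adjoint_op :: "'h::complex_hilbert operator \<Rightarrow> 'h operator" where
  "adjoint_op A = {(g, h). \<forall>(f, k) \<in> A. cinner k g = cinner f h}"

definition symmetric_op :: "'h::complex_hilbert operator \<Rightarrow> bool" where
  "symmetric_op A \<longleftrightarrow> A \<subseteq> adjoint_op A"

definition self_adjoint :: "'h::complex_hilbert operator \<Rightarrow> bool" where
  "self_adjoint A \<longleftrightarrow> linear_operator A \<and> densely_defined A \<and> adjoint_op A = A"

definition resolvent_set :: "'h::complex_hilbert operator \<Rightarrow> complex set" where
  "resolvent_set A = {z. (\<forall>h. \<exists>!f. (f, h + z *\<^sub>C f) \<in> A)
     \<and> (\<exists>C. \<forall>(f, g) \<in> A. norm f \<le> C * norm (g - z *\<^sub>C f))}"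

definition eigenspace :: "'h::complex_hilbert operator \<Rightarrow> complex \<Rightarrow> 'h set" where
  "eigenspace A z = {f. (f, z *\<^sub>C f) \<in> A}"

definition orth_compl :: "'h::complex_hilbert set \<Rightarrow> 'h set" where
  "orth_compl M = {x. \<forall>m\<in>M. cinner x m = 0}"

(* The orthogonal projection P onto M satisfies P Dom(A) <= Dom(A) and A P f = P A f on Dom(A). *)
definition reduces :: "'h::complex_hilbert set \<Rightarrow> 'h operator \<Rightarrow> bool" where
  "reduces M A \<longleftrightarrow> (\<forall>(f, g) \<in> A. \<exists>(f', g') \<in> A \<inter> (M \<times> M).
     f - f' \<in> orth_compl M \<and> g - g' \<in> orth_compl M)"

definition induces_self_adjoint :: "'h::complex_hilbert operator \<Rightarrow> 'h set \<Rightarrow> bool" where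
  "induces_self_adjoint A M \<longleftrightarrow> closure (Domain (A \<inter> (M \<times> M))) = M
     \<and> adjoint_op (A \<inter> (M \<times> M)) \<inter> (M \<times> M) = A \<inter> (M \<times> M)"

definition prime_op :: "'h::complex_hilbert operator \<Rightarrow> bool" where
  "prime_op A \<longleftrightarrow> \<not> (\<exists>M. complex_vector.subspace M \<and> closed M \<and> M \<noteq> {0}
     \<and> reduces M A \<and> induces_self_adjoint A M)"

definition deficiency_indices_1_1 :: "'h::complex_hilbert operator \<Rightarrow> bool" where
  "deficiency_indices_1_1 A \<longleftrightarrow>
     complex_vector.dim (eigenspace (adjoint_op A) \<i>) = 1
     \<and> complex_vector.dim (eigenspace (adjoint_op A) (- \<i>)) = 1"

definition admissible_symmetric :: "'h::complex_hilbert operator \<Rightarrow> bool" where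
  "admissible_symmetric A \<longleftrightarrow> linear_operator A \<and> closed A \<and> densely_defined A
     \<and> symmetric_op A \<and> prime_op A \<and> deficiency_indices_1_1 A"


section \<open>The rigged Hilbert space\<close>

definition plus_space :: "'h::complex_hilbert operator \<Rightarrow> 'h set" where
  "plus_space A = Domain (adjoint_op A)"

definition plus_inner :: "'h::complex_hilbert operator \<Rightarrow> 'h \<Rightarrow> 'h \<Rightarrow> complex" where
  "plus_inner A f g =
     cinner f g + cinner (op_app (adjoint_op A) f) (op_app (adjoint_op A) g)"

definition plus_norm :: "'h::complex_hilbert operator \<Rightarrow> 'h \<Rightarrow> real" where
  "plus_norm A f = sqrt (Re (plus_inner A f f))"

(* An element phi of the negative space is represented by the functional f |-> (phi, f) on the
   positive space: antilinear, bounded with respect to the plus norm, and set to 0 outside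
   the positive space, so that equality of functions is equality in the negative space. *)
definition minus_space :: "'h::complex_hilbert operator \<Rightarrow> ('h \<Rightarrow> complex) set" where
  "minus_space A = {\<phi>.
     (\<forall>f\<in>plus_space A. \<forall>g\<in>plus_space A. \<phi> (f + g) = \<phi> f + \<phi> g)
     \<and> (\<forall>c. \<forall>f\<in>plus_space A. \<phi> (c *\<^sub>C f) = cnj c * \<phi> f)
     \<and> (\<exists>C. \<forall>f\<in>plus_space A. cmod (\<phi> f) \<le> C * plus_norm A f)
     \<and> (\<forall>f. f \<notin> plus_space A \<longrightarrow> \<phi> f = 0)}"

definition minus_norm :: "'h::complex_hilbert operator \<Rightarrow> ('h \<Rightarrow> complex) \<Rightarrow> real" where
  "minus_norm A \<phi> = (SUP f\<in>{f \<in> plus_space A. plus_norm A f \<le> 1}. cmod (\<phi> f))"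

(* the inclusion of the Hilbert space into the negative space *)
definition embed :: "'h::complex_hilbert operator \<Rightarrow> 'h \<Rightarrow> 'h \<Rightarrow> complex" where
  "embed A h = (\<lambda>f. if f \<in> plus_space A then cinner h f else 0)"

(* [H_+, H_-]; only the values of X on H_+ are relevant. *)
definition bounded_plus_minus ::
    "'h::complex_hilbert operator \<Rightarrow> ('h \<Rightarrow> 'h \<Rightarrow> complex) \<Rightarrow> bool" where
  "bounded_plus_minus A X \<longleftrightarrow>
     (\<forall>f\<in>plus_space A. X f \<in> minus_space A)
     \<and> (\<forall>f\<in>plus_space A. \<forall>g\<in>plus_space A. X (f + g) = (\<lambda>k. X f k + X g k))
     \<and> (\<forall>c. \<forall>f\<in>plus_space A. X (c *\<^sub>C f) = (\<lambda>k. c * X f k))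
     \<and> (\<exists>C. \<forall>f\<in>plus_space A. minus_norm A (X f) \<le> C * plus_norm A f)"

(* (X f, g) = (f, X* g), where (f, phi) is the conjugate of (phi, f) *)
definition adj_pm ::
    "'h::complex_hilbert operator \<Rightarrow> ('h \<Rightarrow> 'h \<Rightarrow> complex) \<Rightarrow> 'h \<Rightarrow> 'h \<Rightarrow> complex" where
  "adj_pm A X g = (\<lambda>f. if f \<in> plus_space A then cnj (X f g) else 0)"

definition re_pm ::
    "'h::complex_hilbert operator \<Rightarrow> ('h \<Rightarrow> 'h \<Rightarrow> complex) \<Rightarrow> 'h \<Rightarrow> 'h \<Rightarrow> complex" where
  "re_pm A X f = (\<lambda>g. (X f g + adj_pm A X f g) / 2)"

definition im_pm ::
    "'h::complex_hilbert operator \<Rightarrow> ('h \<Rightarrow> 'h \<Rightarrow> complex) \<Rightarrow> 'h \<Rightarrow> 'h \<Rightarrow> complex" where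
  "im_pm A X f = (\<lambda>g. (X f g - adj_pm A X f g) / (2 * \<i>))"

definition quasi_kernel ::
    "'h::complex_hilbert operator \<Rightarrow> ('h \<Rightarrow> 'h \<Rightarrow> complex) \<Rightarrow> 'h operator" where
  "quasi_kernel A Y = {(f, h). f \<in> plus_space A \<and> Y f = embed A h}"

definition extends_to_pm ::
    "'h::complex_hilbert operator \<Rightarrow> 'h operator \<Rightarrow> ('h \<Rightarrow> 'h \<Rightarrow> complex) \<Rightarrow> bool" where
  "extends_to_pm A T X \<longleftrightarrow> (\<forall>(f, h) \<in> T. f \<in> plus_space A \<and> X f = embed A h)"

(* [C, H_-] *)
definition bounded_C_minus ::
    "'h::complex_hilbert operator \<Rightarrow> (complex \<Rightarrow> 'h \<Rightarrow> complex) \<Rightarrow> bool" where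
  "bounded_C_minus A K \<longleftrightarrow>
     (\<forall>c. K c \<in> minus_space A)
     \<and> (\<forall>c d. K (c + d) = (\<lambda>f. K c f + K d f))
     \<and> (\<forall>c d. K (c * d) = (\<lambda>f. c * K d f))
     \<and> (\<exists>C. \<forall>c. minus_norm A (K c) \<le> C * cmod c)"

(* K* : H_+ -> C is determined by (K c, f) = c * cnj (K* f) for all c. *)
definition adj_K :: "(complex \<Rightarrow> 'h \<Rightarrow> complex) \<Rightarrow> 'h \<Rightarrow> complex" where
  "adj_K K f = cnj (K 1 f)"

lemma adj_K_eq: "bounded_C_minus A K \<Longrightarrow> K c f = c * cnj (adj_K K f)"
  unfolding bounded_C_minus_def adj_K_def by (metis complex_cnj_cnj mult.right_neutral)


section \<open>L-systems\<close>

definition main_operator :: "'h::complex_hilbert operator \<Rightarrow> 'h operator \<Rightarrow> bool" where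
  "main_operator A T \<longleftrightarrow> linear_operator T \<and> \<not> symmetric_op T
     \<and> A \<subseteq> T \<and> T \<subseteq> adjoint_op A \<and> resolvent_set T \<noteq> {}
     \<and> Domain A = Domain T \<inter> Domain (adjoint_op T)"

definition star_extension ::
    "'h::complex_hilbert operator \<Rightarrow> 'h operator \<Rightarrow> ('h \<Rightarrow> 'h \<Rightarrow> complex) \<Rightarrow> bool" where
  "star_extension A T X \<longleftrightarrow> bounded_plus_minus A X
     \<and> A \<subseteq> T \<and> extends_to_pm A T X
     \<and> A \<subseteq> adjoint_op T \<and> extends_to_pm A (adjoint_op T) (adj_pm A X)
     \<and> self_adjoint (quasi_kernel A (re_pm A X))"

record 'h lsystem =
  sym_op :: "'h operator"
  main_op :: "'h operator"
  state_op :: "'h \<Rightarrow> 'h \<Rightarrow> complex"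
  channel :: "complex \<Rightarrow> 'h \<Rightarrow> complex"

definition L_system :: "'h::complex_hilbert lsystem \<Rightarrow> bool" where
  "L_system \<Theta> \<longleftrightarrow> admissible_symmetric (sym_op \<Theta>)
     \<and> main_operator (sym_op \<Theta>) (main_op \<Theta>)
     \<and> star_extension (sym_op \<Theta>) (main_op \<Theta>) (state_op \<Theta>)
     \<and> bounded_C_minus (sym_op \<Theta>) (channel \<Theta>)
     \<and> (\<forall>f\<in>plus_space (sym_op \<Theta>).
          im_pm (sym_op \<Theta>) (state_op \<Theta>) f = channel \<Theta> (adj_K (channel \<Theta>) f))
     \<and> range (channel \<Theta>) = im_pm (sym_op \<Theta>) (state_op \<Theta>) ` plus_space (sym_op \<Theta>)"

definition re_quasi_kernel :: "'h::complex_hilbert lsystem \<Rightarrow> 'h operator" where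
  "re_quasi_kernel \<Theta> = quasi_kernel (sym_op \<Theta>) (re_pm (sym_op \<Theta>) (state_op \<Theta>))"

(* The operator K* (Re A - z I)^{-1} K on the complex numbers is identified with its value at 1;
   the THE term is (Re A - z I)^{-1} K 1. Meaningful for z in resolvent_set (re_quasi_kernel Theta). *)
definition impedance :: "'h::complex_hilbert lsystem \<Rightarrow> complex \<Rightarrow> complex" where
  "impedance \<Theta> z = adj_K (channel \<Theta>)
     (THE f. f \<in> plus_space (sym_op \<Theta>)
        \<and> (\<lambda>g. re_pm (sym_op \<Theta>) (state_op \<Theta>) f g - z * embed (sym_op \<Theta>) f g)
          = channel \<Theta> 1)"


section \<open>The class of impedance functions and the von Neumann parameters\<close>

definition class_M :: "real \<Rightarrow> (complex \<Rightarrow> complex) \<Rightarrow> bool" where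
  "class_M \<kappa>\<^sub>0 V \<longleftrightarrow> 0 \<le> \<kappa>\<^sub>0 \<and> \<kappa>\<^sub>0 < 1
     \<and> (\<exists>\<mu> :: real measure. sets \<mu> = sets borel \<and> emeasure \<mu> UNIV = \<infinity>
          \<and> (\<integral>\<^sup>+ t. ennreal (1 / (1 + t\<^sup>2)) \<partial>\<mu>) = ennreal ((1 - \<kappa>\<^sub>0) / (1 + \<kappa>\<^sub>0))
          \<and> (\<forall>z. Im z \<noteq> 0 \<longrightarrow>
               V z = (LINT t|\<mu>. 1 / (complex_of_real t - z) - complex_of_real (t / (1 + t\<^sup>2)))))"

(* Normalized deficiency vectors whose relative phase makes the parameter k of T nonnegative. *)
definition normalized_pair ::
    "'h::complex_hilbert operator \<Rightarrow> 'h operator \<Rightarrow> 'h \<Rightarrow> 'h \<Rightarrow> real \<Rightarrow> bool" where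
  "normalized_pair A T gp gm k \<longleftrightarrow>
     gp \<in> eigenspace (adjoint_op A) \<i> \<and> gm \<in> eigenspace (adjoint_op A) (- \<i>)
     \<and> norm gp = 1 \<and> norm gm = 1
     \<and> 0 \<le> k \<and> k < 1 \<and> gp - complex_of_real k *\<^sub>C gm \<in> Domain T"

definition vN_parameter ::
    "'h::complex_hilbert operator \<Rightarrow> 'h operator \<Rightarrow> real \<Rightarrow> bool" where
  "vN_parameter A T k \<longleftrightarrow> (\<exists>gp gm. normalized_pair A T gp gm k)"

(* the parameter u of the self-adjoint extension S, with respect to the pair chosen for T *)
definition vN_parameter_sa ::
    "'h::complex_hilbert operator \<Rightarrow> 'h operator \<Rightarrow> 'h operator \<Rightarrow> complex \<Rightarrow> bool" where
  "vN_parameter_sa A T S u \<longleftrightarrow> (\<exists>gp gm k. normalized_pair A T gp gm k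
     \<and> cmod u = 1 \<and> gp + u *\<^sub>C gm \<in> Domain S)"

end

theory Submission
  imports Defs
begin

text \<open>
  Modulo \<open>Dom A\<close> the domain of \<open>A*\<close> is two-dimensional, and an L-system over \<open>A\<close> amounts to a pair of
  linear functionals \<open>G0\<close>, \<open>G1\<close> on it with the Green identity
  \<open>(A* f, g) - (f, A* g) = cnj (G0 g) G1 f - G0 f cnj (G1 g)\<close>: the channel vector is \<open>\<chi> = cnj G1\<close>, the
  state operator is \<open>f \<mapsto> A* f + (G0 f + \<i> G1 f) \<chi>\<close>, the main operator and the quasi-kernel are the
  restrictions of \<open>A*\<close> to the kernels of \<open>G0 + \<i> G1\<close> and of \<open>G0\<close>, and the impedance function at \<open>z\<close> is
  the ratio \<open>G1 / G0\<close> on \<open>Ker (A* - z)\<close>. Replacing \<open>G1\<close> by \<open>G1 + Q G0\<close> preserves the Green identity and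
  the quasi-kernel, and adds \<open>Q\<close> to the impedance. Membership in the class enters only through the
  values \<open>\<plusminus> a \<i>\<close> of the given impedance at \<open>\<plusminus> \<i>\<close>; the new values \<open>Q \<plusminus> a \<i>\<close> determine both
  von Neumann parameters.
\<close>

section \<open>Complex Hilbert spaces\<close>

lemma cinner_add_right: "cinner x (y + z) = cinner x y + cinner x z"
  by (metis cinner_add_left cinner_commute complex_cnj_add)

lemma cinner_scaleC_right: "cinner x (c *\<^sub>C y) = cnj c * cinner x y"
  by (metis cinner_commute cinner_scaleC_left complex_cnj_mult)

lemma cinner_zero_left [simp]: "cinner 0 x = 0"
  using cinner_add_left[of 0 0 x] by simp

lemma cinner_zero_right [simp]: "cinner x 0 = 0"
  using cinner_add_right[of x 0 0] by simp

lemma cinner_minus_left: "cinner (- x) y = - cinner x y"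
  using cinner_add_left[of x "- x" y] by (simp add: minus_unique)

lemma cinner_minus_right: "cinner x (- y) = - cinner x y"
  using cinner_add_right[of x y "- y"] by (simp add: minus_unique)

lemma cinner_diff_left: "cinner (x - y) z = cinner x z - cinner y z"
  using cinner_add_left[of x "- y" z] by (simp add: cinner_minus_left)

lemma cinner_diff_right: "cinner x (y - z) = cinner x y - cinner x z"
  using cinner_add_right[of x y "- z"] by (simp add: cinner_minus_right)

lemmas cinner_distribs = cinner_add_left cinner_add_right cinner_diff_left cinner_diff_right
  cinner_scaleC_left cinner_scaleC_right cinner_minus_left cinner_minus_right

lemma cinner_self: "cinner x x = complex_of_real ((norm x)\<^sup>2)"
proof -
  have "Im (cinner x x) = 0"
    using arg_cong[OF cinner_commute[of x x], of Im] by simp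
  moreover have "0 \<le> Re (cinner x x)"
    using norm_ge_zero[of x] unfolding norm_eq_sqrt_cinner by simp
  ultimately show ?thesis
    by (simp add: complex_eq_iff norm_eq_sqrt_cinner)
qed

lemma norm_scaleC: "norm (c *\<^sub>C x) = cmod c * norm (x::'a::complex_hilbert)"
proof -
  have "complex_of_real ((norm (c *\<^sub>C x))\<^sup>2) = complex_of_real ((cmod c * norm x)\<^sup>2)"
    by (simp only: cinner_self[symmetric] cinner_distribs)
       (simp add: cinner_self power_mult_distrib mult.commute[of "cnj _"] flip: complex_norm_square)
  then have "(norm (c *\<^sub>C x))\<^sup>2 = (cmod c * norm x)\<^sup>2"
    using of_real_eq_iff by blast
  then show ?thesis by (simp add: power2_eq_iff_nonneg)
qed

lemma norm_add_square: "(norm (x + y))\<^sup>2 = (norm x)\<^sup>2 + (norm y)\<^sup>2 + 2 * Re (cinner x y)"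
proof -
  have "complex_of_real ((norm (x + y))\<^sup>2)
      = complex_of_real ((norm x)\<^sup>2) + complex_of_real ((norm y)\<^sup>2) + cinner x y + cnj (cinner x y)"
    by (simp only: cinner_self[symmetric] cinner_distribs cinner_commute[of y x])
       (simp add: algebra_simps)
  then show ?thesis by (simp add: complex_eq_iff)
qed

lemma norm_diff_square: "(norm (x - y))\<^sup>2 = (norm x)\<^sup>2 + (norm y)\<^sup>2 - 2 * Re (cinner x y)"
  using norm_add_square[of x "- y"] by (simp add: cinner_minus_right)

text \<open>Expand the square with the coefficient of the projection of \<open>x\<close> onto
  \<open>y\<close>. Both the orthogonality criterion and the Cauchy-Schwarz inequality below are
  read off from this identity.\<close>

lemma norm_minus_projection:
  assumes "y \<noteq> 0"
  shows "(norm (x - (cinner x y / complex_of_real ((norm y)\<^sup>2)) *\<^sub>C y))\<^sup>2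
    = (norm x)\<^sup>2 - (cmod (cinner x y))\<^sup>2 / (norm y)\<^sup>2"
proof -
  define c where "c = cinner x y / complex_of_real ((norm y)\<^sup>2)"
  have "(norm (x - c *\<^sub>C y))\<^sup>2 = (norm x)\<^sup>2 + (cmod c * norm y)\<^sup>2 - 2 * Re (cnj c * cinner x y)"
    by (simp add: norm_diff_square norm_scaleC cinner_scaleC_right)
  also have "cnj c * cinner x y = complex_of_real ((cmod (cinner x y))\<^sup>2 / (norm y)\<^sup>2)"
    by (simp add: c_def mult.commute[of "cnj _"] flip: complex_norm_square)
  also have "(cmod c * norm y)\<^sup>2 = (cmod (cinner x y))\<^sup>2 / (norm y)\<^sup>2"
    using assms by (simp add: c_def norm_divide norm_power field_simps)
  finally show ?thesis by (simp add: c_def)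
qed

text \<open>Taking for \<open>c\<close> the projection coefficient would strictly shorten
  \<open>x\<close> unless the inner product vanishes.\<close>

lemma orthogonal_if_norm_minimal:
  assumes "\<And>c. norm x \<le> norm (x - c *\<^sub>C y)"
  shows "cinner x y = 0"
proof (cases "y = 0")
  case False
  have "(norm x)\<^sup>2 \<le> (norm x)\<^sup>2 - (cmod (cinner x y))\<^sup>2 / (norm y)\<^sup>2"
    unfolding norm_minus_projection[OF False, symmetric] using assms by (intro power_mono) auto
  with False show ?thesis by (simp add: divide_le_0_iff)
qed simp

lemma cinner_Cauchy_Schwarz: "cmod (cinner x y) \<le> norm x * norm y"
proof (cases "y = 0")
  case False
  have "0 \<le> (norm x)\<^sup>2 - (cmod (cinner x y))\<^sup>2 / (norm y)\<^sup>2"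
    unfolding norm_minus_projection[OF False, symmetric] by simp
  then have "(cmod (cinner x y))\<^sup>2 \<le> (norm x * norm y)\<^sup>2"
    using False by (simp add: pos_divide_le_eq power_mult_distrib)
  then show ?thesis by (rule power2_le_imp_le) simp
qed simp

lemma tendsto_cinner_left: "(f \<longlongrightarrow> x) F \<Longrightarrow> ((\<lambda>n. cinner (f n) y) \<longlongrightarrow> cinner x y) F"
proof -
  assume f: "(f \<longlongrightarrow> x) F"
  have "((\<lambda>n. norm (f n - x) * norm y) \<longlongrightarrow> 0) F"
    using f by (auto intro!: tendsto_mult_left_zero tendsto_norm_zero simp: LIM_zero_iff)
  then have "((\<lambda>n. cinner (f n) y - cinner x y) \<longlongrightarrow> 0) F"
    by (rule Lim_null_comparison[rotated])
       (simp add: cinner_diff_left[symmetric] cinner_Cauchy_Schwarz)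
  then show ?thesis by (simp add: LIM_zero_iff)
qed

lemma orthogonal_dense_eq_0:
  assumes "closure D = UNIV" and "\<And>f. f \<in> D \<Longrightarrow> cinner f x = 0"
  shows "x = 0"
proof -
  have "x \<in> closure D" using assms(1) by simp
  then obtain f where f: "\<And>n. f n \<in> D" "f \<longlonglongrightarrow> x"
    unfolding closure_sequential by blast
  have "(\<lambda>n. cinner (f n) x) \<longlonglongrightarrow> cinner x x" by (rule tendsto_cinner_left[OF f(2)])
  moreover have "(\<lambda>n. cinner (f n) x) = (\<lambda>n. 0)" using assms(2) f(1) by simp
  ultimately have "cinner x x = 0" by (simp add: LIMSEQ_const_iff)
  then show ?thesis by (simp add: cinner_self)
qed

text \<open>Projection theorem: a sequence in \<open>M\<close> minimizing the distance to
  \<open>x\<close> is Cauchy by the parallelogram law, its limit lies in \<open>M\<close> and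
  attains the distance, and minimality gives orthogonality.\<close>

lemma closed_subspace_decomposition:
  fixes M :: "'a::complex_hilbert set"
  assumes M: "complex_vector.subspace M" and cl: "closed M"
  obtains m where "m \<in> M" "x - m \<in> orth_compl M"
proof -
  define d where "d = infdist x M"
  have ne: "M \<noteq> {}" using complex_vector.subspace_0[OF M] by auto
  have d0: "0 \<le> d" by (simp add: d_def infdist_nonneg)
  have dle: "d \<le> norm (x - m)" if "m \<in> M" for m
    using infdist_le[OF that, of x] by (simp add: d_def dist_norm)
  have "\<exists>m\<in>M. (norm (x - m))\<^sup>2 < d\<^sup>2 + inverse (real (Suc n))" for n
  proof -
    have "d < sqrt (d\<^sup>2 + inverse (real (Suc n)))"
      by (rule real_less_rsqrt) simp
    then obtain m where "m \<in> M" "dist x m < sqrt (d\<^sup>2 + inverse (real (Suc n)))"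
      using ne by (auto simp: d_def infdist_def cINF_less_iff)
    moreover from this have "(norm (x - m))\<^sup>2 < d\<^sup>2 + inverse (real (Suc n))"
      by (metis dist_norm not_less real_le_rsqrt real_sqrt_le_iff real_sqrt_unique norm_ge_zero)
    ultimately show ?thesis by blast
  qed
  then obtain m where mM: "\<And>n. m n \<in> M"
    and m: "\<And>n. (norm (x - m n))\<^sup>2 < d\<^sup>2 + inverse (real (Suc n))" by metis
  have par: "(norm (m j - m k))\<^sup>2 \<le> 2 * (norm (x - m j))\<^sup>2 + 2 * (norm (x - m k))\<^sup>2 - 4 * d\<^sup>2" for j k
  proof -
    \<comment> \<open>The midpoint lies in \<open>M\<close>, so its distance from \<open>x\<close>
      is at least \<open>d\<close>; this bounds the sum in the parallelogram law from below.\<close>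
    let ?c = "(1/2) *\<^sub>C (m j + m k)"
    have "?c \<in> M" using M mM by (intro complex_vector.subspace_scale complex_vector.subspace_add)
    then have "d\<^sup>2 \<le> (norm (x - ?c))\<^sup>2" using dle d0 by (intro power_mono) auto
    moreover have "(x - m j) + (x - m k) = 2 *\<^sub>C (x - ?c)"
      using scaleC_add_left[of 1 1 x]
      by (simp add: complex_vector.scale_right_diff_distrib scaleC_scaleC scaleC_one)
    then have "(norm ((x - m j) + (x - m k)))\<^sup>2 = 4 * (norm (x - ?c))\<^sup>2"
      by (simp add: norm_scaleC power_mult_distrib)
    moreover have "m j - m k = (x - m k) - (x - m j)" by simp
    then have "(norm (m j - m k))\<^sup>2
        = (norm (x - m k))\<^sup>2 + (norm (x - m j))\<^sup>2 - 2 * Re (cinner (x - m k) (x - m j))"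
      by (metis norm_diff_square)
    moreover have "Re (cinner (x - m k) (x - m j)) = Re (cinner (x - m j) (x - m k))"
      by (subst cinner_commute) simp
    ultimately show ?thesis using norm_add_square[of "x - m j" "x - m k"] by linarith
  qed
  have "Cauchy m"
  proof (rule metric_CauchyI)
    fix e :: real assume e: "0 < e"
    then obtain N where N: "inverse (real (Suc N)) < e\<^sup>2 / 4"
      using reals_Archimedean[of "e\<^sup>2 / 4"] by auto
    have "dist (m j) (m k) < e" if "N \<le> j" "N \<le> k" for j k
    proof -
      have "inverse (real (Suc j)) \<le> inverse (real (Suc N))"
           "inverse (real (Suc k)) \<le> inverse (real (Suc N))"
        using that by (auto intro!: le_imp_inverse_le)
      then have "(norm (m j - m k))\<^sup>2 < e\<^sup>2"
        using par[of j k] m[of j] m[of k] N by linarith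
      then show ?thesis using e by (simp add: dist_norm power2_less_imp_less)
    qed
    then show "\<exists>N. \<forall>j\<ge>N. \<forall>k\<ge>N. dist (m j) (m k) < e" by blast
  qed
  then obtain l where l: "m \<longlonglongrightarrow> l" using Cauchy_convergent convergent_def by blast
  have lM: "l \<in> M" using closed_sequentially[OF cl] mM l by blast
  have "(\<lambda>n. (norm (x - m n))\<^sup>2) \<longlonglongrightarrow> (norm (x - l))\<^sup>2" using l by (intro tendsto_intros)
  moreover have "(\<lambda>n. d\<^sup>2 + inverse (real (Suc n))) \<longlonglongrightarrow> d\<^sup>2 + 0"
    by (intro tendsto_intros LIMSEQ_inverse_real_of_nat)
  ultimately have "(norm (x - l))\<^sup>2 \<le> d\<^sup>2"
    using LIMSEQ_le[of "\<lambda>n. (norm (x - m n))\<^sup>2" _ "\<lambda>n. d\<^sup>2 + inverse (real (Suc n))" "d\<^sup>2 + 0"]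
      m[THEN less_imp_le] by simp
  then have nl: "norm (x - l) \<le> d" using d0 by (rule power2_le_imp_le)
  have "cinner (x - l) k = 0" if "k \<in> M" for k
  proof (rule orthogonal_if_norm_minimal)
    fix c
    have "l + c *\<^sub>C k \<in> M"
      using M lM that by (intro complex_vector.subspace_scale complex_vector.subspace_add)
    from dle[OF this] nl show "norm (x - l) \<le> norm (x - l - c *\<^sub>C k)"
      by (simp add: diff_diff_eq)
  qed
  then show ?thesis using that lM by (auto simp: orth_compl_def)
qed

section \<open>Symmetric operators with deficiency indices (1,1)\<close>

definition range_shift :: "'h::complex_hilbert operator \<Rightarrow> complex \<Rightarrow> 'h set" where
  "range_shift A c = {g + c *\<^sub>C f | f g. (f, g) \<in> A}"

lemma range_shiftI: "(f, g) \<in> A \<Longrightarrow> x = g + c *\<^sub>C f \<Longrightarrow> x \<in> range_shift A c"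
  by (auto simp: range_shift_def)

lemma adjoint_opD: "(g, h) \<in> adjoint_op A \<Longrightarrow> (f, k) \<in> A \<Longrightarrow> cinner k g = cinner f h"
  by (auto simp: adjoint_op_def)

lemma adjoint_opI: "(\<And>f k. (f, k) \<in> A \<Longrightarrow> cinner k g = cinner f h) \<Longrightarrow> (g, h) \<in> adjoint_op A"
  by (auto simp: adjoint_op_def)

lemma adjoint_op_antimono: "A \<subseteq> B \<Longrightarrow> adjoint_op B \<subseteq> adjoint_op A"
  by (fastforce simp: adjoint_op_def)

lemma linear_operator_add:
  "linear_operator A \<Longrightarrow> (x, y) \<in> A \<Longrightarrow> (x', y') \<in> A \<Longrightarrow> (x + x', y + y') \<in> A"
  by (simp add: linear_operator_def)

lemma linear_operator_scale: "linear_operator A \<Longrightarrow> (x, y) \<in> A \<Longrightarrow> (c *\<^sub>C x, c *\<^sub>C y) \<in> A"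
  by (simp add: linear_operator_def)

lemma linear_operator_diff:
  assumes "linear_operator A" "(x, y) \<in> A" "(x', y') \<in> A"
  shows "(x - x', y - y') \<in> A"
  using linear_operator_add[OF assms(1,2) linear_operator_scale[OF assms(1,3), of "-1"]]
  by (simp add: scaleC_one)

lemma linear_operator_fun: "linear_operator A \<Longrightarrow> (x, y) \<in> A \<Longrightarrow> (x, y') \<in> A \<Longrightarrow> y = y'"
  by (auto simp: linear_operator_def dest: single_valuedD)

lemma linear_adjoint_op:
  assumes "densely_defined A"
  shows "linear_operator (adjoint_op A)"
proof -
  have "single_valued (adjoint_op A)"
  proof (rule single_valuedI)
    fix x y z assume xy: "(x, y) \<in> adjoint_op A" "(x, z) \<in> adjoint_op A"
    have "y - z = 0"
    proof (rule orthogonal_dense_eq_0)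
      show "closure (Domain A) = UNIV" using assms by (simp add: densely_defined_def)
      fix f assume "f \<in> Domain A"
      then show "cinner f (y - z) = 0"
        using xy[THEN adjoint_opD] by (fastforce simp: cinner_diff_right)
    qed
    then show "y = z" by simp
  qed
  then show ?thesis
    by (auto simp: linear_operator_def adjoint_op_def cinner_add_right cinner_scaleC_right) fastforce+
qed

lemma self_adjoint_symmetric:
  "self_adjoint S \<Longrightarrow> (f, g) \<in> S \<Longrightarrow> (f', g') \<in> S \<Longrightarrow> cinner g f' = cinner f g'"
  unfolding self_adjoint_def by (metis adjoint_opD)

text \<open>Symmetry makes eigenvalues real. This later gives the uniqueness of
  \<open>(Re A - z)^{-1} K 1\<close> at \<open>z = i\<close> and \<open>z = -i\<close> without a
  discussion of the resolvent set.\<close>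

lemma self_adjoint_eigenvalue:
  assumes "self_adjoint S" "(f, z *\<^sub>C f) \<in> S" "Im z \<noteq> 0"
  shows "f = 0"
proof -
  have "z * cinner f f = cnj z * cinner f f"
    using self_adjoint_symmetric[OF assms(1,2,2)] by (simp add: cinner_distribs)
  moreover have "z \<noteq> cnj z" using assms(3) by (simp add: complex_eq_iff)
  ultimately show ?thesis by (simp add: cinner_self)
qed

lemma dim_1_unit_vector:
  fixes M :: "'a::complex_hilbert set"
  assumes "complex_vector.subspace M" "complex_vector.dim M = 1"
  obtains g where "g \<in> M" "norm g = 1" "\<And>x. x \<in> M \<Longrightarrow> \<exists>c. x = c *\<^sub>C g"
proof -
  obtain B where B: "B \<subseteq> M" "complex_vector.independent B" "M \<subseteq> complex_vector.span B" "card B = 1"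
    using complex_vector.basis_exists[of M] assms(2) by metis
  then obtain e where e: "B = {e}" by (auto simp: card_1_singleton_iff)
  have e0: "e \<noteq> 0" using B(2) e complex_vector.dependent_zero[of B] by auto
  define g where "g = complex_of_real (1 / norm e) *\<^sub>C e"
  have "g \<in> M" using assms(1) B(1) e by (simp add: g_def complex_vector.subspace_scale)
  moreover have "norm g = 1" using e0 by (simp add: g_def norm_scaleC norm_divide)
  moreover have "\<exists>c. x = c *\<^sub>C g" if "x \<in> M" for x
  proof -
    have "x \<in> complex_vector.span {e}" using that B(3) e by auto
    then obtain c where "x = c *\<^sub>C e" by (auto simp: complex_vector.span_singleton)
    then have "x = (c * complex_of_real (norm e)) *\<^sub>C g"
      using e0 by (simp add: g_def scaleC_scaleC)
    then show ?thesis ..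
  qed
  ultimately show ?thesis using that by blast
qed

section \<open>The boundary form of the adjoint and the range of \<open>A + i\<close>\<close>

locale symmetric_1_1 =
  fixes A :: "'h::complex_hilbert operator"
  assumes admissible: "admissible_symmetric A"
begin

lemma
  shows linear_A: "linear_operator A" and closed_A: "closed A" and dense_A: "densely_defined A"
    and symmetric_A: "A \<subseteq> adjoint_op A"
  using admissible by (auto simp: admissible_symmetric_def symmetric_op_def)

abbreviation "Hp \<equiv> plus_space A"
abbreviation "Astar \<equiv> op_app (adjoint_op A)"
abbreviation "N z \<equiv> eigenspace (adjoint_op A) z"

lemma linear_Astar: "linear_operator (adjoint_op A)"
  by (rule linear_adjoint_op[OF dense_A])

lemma adjoint_iff: "(f, g) \<in> adjoint_op A \<longleftrightarrow> f \<in> Hp \<and> g = Astar f"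
proof -
  have "(f, g) \<in> adjoint_op A \<Longrightarrow> Astar f = g" for g
    unfolding op_app_def using linear_operator_fun[OF linear_Astar] by blast
  then show ?thesis by (auto simp: plus_space_def)
qed

lemma A_iff: "(f, g) \<in> A \<longleftrightarrow> f \<in> Domain A \<and> g = Astar f"
  using symmetric_A adjoint_iff by (metis Domain_iff subsetD)

lemma Domain_A_subset: "f \<in> Domain A \<Longrightarrow> f \<in> Hp"
  using symmetric_A by (auto simp: plus_space_def)

lemma Astar_pair: "f \<in> Hp \<Longrightarrow> (f, Astar f) \<in> adjoint_op A"
  by (simp add: adjoint_iff)

lemma Astar_zero: "0 \<in> Hp \<and> Astar 0 = 0"
  using linear_Astar by (simp add: linear_operator_def adjoint_iff)

lemma Astar_add: "f \<in> Hp \<Longrightarrow> g \<in> Hp \<Longrightarrow> f + g \<in> Hp \<and> Astar (f + g) = Astar f + Astar g"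
  using linear_operator_add[OF linear_Astar Astar_pair Astar_pair, of f g]
  by (simp add: adjoint_iff)

lemma Astar_diff: "f \<in> Hp \<Longrightarrow> g \<in> Hp \<Longrightarrow> f - g \<in> Hp \<and> Astar (f - g) = Astar f - Astar g"
  using linear_operator_diff[OF linear_Astar Astar_pair Astar_pair, of f g]
  by (simp add: adjoint_iff)

lemma Astar_scale: "f \<in> Hp \<Longrightarrow> c *\<^sub>C f \<in> Hp \<and> Astar (c *\<^sub>C f) = c *\<^sub>C Astar f"
  using linear_operator_scale[OF linear_Astar Astar_pair, of f c]
  by (simp add: adjoint_iff)

lemmas Astar_linear [simp] = Astar_zero Astar_add Astar_diff Astar_scale

lemma N_iff: "f \<in> N z \<longleftrightarrow> f \<in> Hp \<and> Astar f = z *\<^sub>C f"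
  unfolding eigenspace_def by (auto simp: adjoint_iff)

lemma N_subspace: "complex_vector.subspace (N z)"
  unfolding complex_vector.subspace_def
  by (auto simp: N_iff Astar_linear scaleC_add_right scaleC_scaleC mult.commute)

lemma deficiency_vectors:
  obtains gp gm where "gp \<in> N \<i>" "gm \<in> N (-\<i>)" "norm gp = 1" "norm gm = 1"
    "\<And>x. x \<in> N \<i> \<Longrightarrow> \<exists>c. x = c *\<^sub>C gp" "\<And>x. x \<in> N (-\<i>) \<Longrightarrow> \<exists>c. x = c *\<^sub>C gm"
proof -
  have "complex_vector.dim (N \<i>) = 1" "complex_vector.dim (N (-\<i>)) = 1"
    using admissible by (auto simp: admissible_symmetric_def deficiency_indices_1_1_def)
  then show ?thesis
    using dim_1_unit_vector[OF N_subspace] that by metis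
qed

text \<open>The boundary form of the adjoint. It is skew-Hermitian and vanishes as soon as one
  argument lies in \<open>Domain A\<close>, so it lives on the quotient of the positive space by
  \<open>Domain A\<close>.\<close>

definition bform :: "'h \<Rightarrow> 'h \<Rightarrow> complex" where
  "bform f g = cinner (Astar f) g - cinner f (Astar g)"

lemma bform_linear:
  shows "f \<in> Hp \<Longrightarrow> f' \<in> Hp \<Longrightarrow> bform (f + f') g = bform f g + bform f' g"
    and "f \<in> Hp \<Longrightarrow> f' \<in> Hp \<Longrightarrow> bform (f - f') g = bform f g - bform f' g"
    and "f \<in> Hp \<Longrightarrow> bform (c *\<^sub>C f) g = c * bform f g"
  by (auto simp: bform_def Astar_linear cinner_distribs algebra_simps)

lemma bform_commute: "bform g f = - cnj (bform f g)"
  using cinner_commute[of "Astar g" f] cinner_commute[of g "Astar f"] by (simp add: bform_def)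

lemma bform_Domain: "f \<in> Domain A \<Longrightarrow> g \<in> Hp \<Longrightarrow> bform f g = 0"
  using A_iff[of f "Astar f"] adjoint_opD[of g "Astar g" A f "Astar f"] adjoint_iff[of g "Astar g"]
  by (simp add: bform_def)

lemma bform_N:
  "f \<in> N z \<Longrightarrow> g \<in> N z' \<Longrightarrow> bform f g = (z - cnj z') * cinner f g"
  by (simp add: N_iff bform_def cinner_distribs algebra_simps)

text \<open>The cross term is twice the imaginary part of \<open>(g, f)\<close>, which is zero for a
  symmetric operator.\<close>

lemma A_norm_shift:
  assumes "(f, g) \<in> A"
  shows "(norm (g + \<i> *\<^sub>C f))\<^sup>2 = (norm g)\<^sup>2 + (norm f)\<^sup>2"
proof -
  have "cinner g f = cnj (cinner g f)"
    using adjoint_opD[of f g A f g] assms symmetric_A cinner_commute[of f g] by auto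
  then have "Im (cinner g f) = 0" by (simp add: complex_eq_iff)
  then show ?thesis by (simp add: norm_add_square norm_scaleC cinner_distribs)
qed

text \<open>By \<open>A_norm_shift\<close>, convergence of \<open>g n + i f n\<close> forces both
  \<open>f n\<close> and \<open>g n\<close> to be Cauchy; the limit pair is in \<open>A\<close>
  because the graph is closed.\<close>

lemma closed_range_shift: "closed (range_shift A \<i>)"
  unfolding closed_sequential_limits
proof (intro allI impI, elim conjE)
  fix x l assume x: "\<forall>n. x n \<in> range_shift A \<i>" and l: "x \<longlonglongrightarrow> l"
  then obtain f g where fg: "\<And>n. (f n, g n) \<in> A" "\<And>n. x n = g n + \<i> *\<^sub>C f n"
    unfolding range_shift_def by simp metis
  have sq: "(norm (x m - x n))\<^sup>2 = (norm (g m - g n))\<^sup>2 + (norm (f m - f n))\<^sup>2" for m n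
  proof -
    have "x m - x n = (g m - g n) + \<i> *\<^sub>C (f m - f n)"
      by (simp add: fg(2) complex_vector.scale_right_diff_distrib)
    then show ?thesis using A_norm_shift[OF linear_operator_diff[OF linear_A fg(1) fg(1)], of m n] by metis
  qed
  have "norm (g m - g n) \<le> norm (x m - x n)" "norm (f m - f n) \<le> norm (x m - x n)" for m n
    using sq[of m n] by (simp_all add: power2_le_imp_le)
  then have le: "dist (g m) (g n) \<le> dist (x m) (x n)" "dist (f m) (f n) \<le> dist (x m) (x n)" for m n
    by (auto simp: dist_norm)
  have x: "Cauchy x" using l by (rule LIMSEQ_imp_Cauchy)
  have transfer: "Cauchy u" if "\<And>m n. dist (u m) (u n) \<le> dist (x m) (x n)" for u :: "nat \<Rightarrow> 'h"
  proof (rule metric_CauchyI)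
    fix e :: real assume "0 < e"
    then obtain M where "\<forall>m\<ge>M. \<forall>n\<ge>M. dist (x m) (x n) < e" using metric_CauchyD[OF x] by blast
    then show "\<exists>M. \<forall>m\<ge>M. \<forall>n\<ge>M. dist (u m) (u n) < e"
      using that le_less_trans by (intro exI[of _ M]) blast
  qed
  have "Cauchy f" "Cauchy g" by (rule transfer[OF le(2)], rule transfer[OF le(1)])
  then obtain f' g' where lim: "f \<longlonglongrightarrow> f'" "g \<longlonglongrightarrow> g'"
    using Cauchy_convergent convergent_def by metis
  have "(\<lambda>n. (f n, g n)) \<longlonglongrightarrow> (f', g')" using lim by (rule tendsto_Pair)
  then have A': "(f', g') \<in> A" by (rule closed_sequentially[OF closed_A fg(1)])
  have "(\<lambda>n. \<i> *\<^sub>C f n) \<longlonglongrightarrow> \<i> *\<^sub>C f'"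
    using lim(1) unfolding LIMSEQ_iff
    by (simp add: norm_scaleC complex_vector.scale_right_diff_distrib[symmetric])
  from tendsto_add[OF lim(2) this] have "x \<longlonglongrightarrow> g' + \<i> *\<^sub>C f'"
    by (simp add: fg(2)[symmetric])
  then have "l = g' + \<i> *\<^sub>C f'" by (rule LIMSEQ_unique[OF l])
  then show "l \<in> range_shift A \<i>" using A' by (auto simp: range_shift_def)
qed

text \<open>The range of \<open>A + i\<close> is a closed subspace, and a vector orthogonal to it is
  exactly an eigenvector of the adjoint for \<open>i\<close>; project \<open>h\<close> onto the
  range.\<close>

lemma range_shift_decomposition:
  obtains f r where "f \<in> Domain A" "r \<in> N \<i>" "h = Astar f + \<i> *\<^sub>C f + r"
proof -
  have "complex_vector.subspace (range_shift A \<i>)"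
    unfolding complex_vector.subspace_def
  proof (intro conjI ballI allI)
    show "0 \<in> range_shift A \<i>"
      using linear_A by (intro range_shiftI[of 0 0]) (simp_all add: linear_operator_def)
  next
    fix x y assume "x \<in> range_shift A \<i>" "y \<in> range_shift A \<i>"
    then obtain f g f' g' where "(f, g) \<in> A" "(f', g') \<in> A" "x = g + \<i> *\<^sub>C f" "y = g' + \<i> *\<^sub>C f'"
      by (auto simp: range_shift_def)
    then show "x + y \<in> range_shift A \<i>"
      using linear_operator_add[OF linear_A, of f g f' g']
      by (intro range_shiftI[of "f + f'" "g + g'"]) (simp_all add: scaleC_add_right)
  next
    fix c x assume "x \<in> range_shift A \<i>"
    then obtain f g where "(f, g) \<in> A" "x = g + \<i> *\<^sub>C f" by (auto simp: range_shift_def)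
    then show "c *\<^sub>C x \<in> range_shift A \<i>"
      using linear_operator_scale[OF linear_A, of f g c]
      by (intro range_shiftI[of "c *\<^sub>C f" "c *\<^sub>C g"])
        (simp_all add: scaleC_add_right scaleC_scaleC mult.commute[of c])
  qed
  then obtain m where m: "m \<in> range_shift A \<i>" "h - m \<in> orth_compl (range_shift A \<i>)"
    using closed_subspace_decomposition[OF _ closed_range_shift] by blast
  obtain f g where fg: "(f, g) \<in> A" "m = g + \<i> *\<^sub>C f" using m(1) by (auto simp: range_shift_def)
  define r where "r = h - m"
  have "(r, \<i> *\<^sub>C r) \<in> adjoint_op A"
  proof (rule adjoint_opI)
    fix f' k assume "(f', k) \<in> A"
    then have "cinner r (k + \<i> *\<^sub>C f') = 0"
      using m(2) range_shiftI[of f' k A _ \<i>] unfolding orth_compl_def r_def by blast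
    then have "cinner (k + \<i> *\<^sub>C f') r = 0"
      by (subst cinner_commute) simp
    then show "cinner k r = cinner f' (\<i> *\<^sub>C r)"
      by (simp add: cinner_distribs eq_neg_iff_add_eq_0)
  qed
  then have "r \<in> N \<i>" by (simp add: eigenspace_def)
  moreover have f: "f \<in> Domain A" and g: "g = Astar f" using fg(1) A_iff[of f g] by simp_all
  moreover have "h = m + r" by (simp add: r_def)
  then have "h = Astar f + \<i> *\<^sub>C f + r" by (simp only: fg(2) g)
  ultimately show ?thesis by (intro that)
qed

end

section \<open>Von Neumann's decomposition of the domain of the adjoint\<close>

locale deficiency_pair = symmetric_1_1 +
  fixes gp gm :: 'a
  assumes gp: "gp \<in> N \<i>" and gm: "gm \<in> N (-\<i>)"
    and norm_gp: "norm gp = 1" and norm_gm: "norm gm = 1"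
begin

lemma N_spanned:
  shows "x \<in> N \<i> \<Longrightarrow> \<exists>c. x = c *\<^sub>C gp" and "x \<in> N (-\<i>) \<Longrightarrow> \<exists>c. x = c *\<^sub>C gm"
proof -
  obtain ep em where e: "\<And>x. x \<in> N \<i> \<Longrightarrow> \<exists>c. x = c *\<^sub>C ep" "\<And>x. x \<in> N (-\<i>) \<Longrightarrow> \<exists>c. x = c *\<^sub>C em"
    using deficiency_vectors by metis
  obtain c d where cd: "gp = c *\<^sub>C ep" "gm = d *\<^sub>C em" using e gp gm by metis
  then have "c \<noteq> 0" "d \<noteq> 0" using norm_gp norm_gm by auto
  then have *: "ep = inverse c *\<^sub>C gp" "em = inverse d *\<^sub>C gm"
    by (simp_all add: cd scaleC_scaleC scaleC_one)
  show "x \<in> N \<i> \<Longrightarrow> \<exists>c. x = c *\<^sub>C gp" "x \<in> N (-\<i>) \<Longrightarrow> \<exists>c. x = c *\<^sub>C gm"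
    by (metis e(1) *(1) scaleC_scaleC) (metis e(2) *(2) scaleC_scaleC)
qed

lemma gpm_simps [simp]:
  shows "gp \<in> Hp" "gm \<in> Hp" "Astar gp = \<i> *\<^sub>C gp" "Astar gm = (-\<i>) *\<^sub>C gm"
  using gp gm by (auto simp: N_iff)

lemma bform_gpm [simp]:
  shows "bform gp gp = 2 * \<i>" "bform gm gm = - 2 * \<i>" "bform gp gm = 0" "bform gm gp = 0"
  using bform_N[OF gp gp] bform_N[OF gm gm] bform_N[OF gp gm] bform_N[OF gm gp]
  by (simp_all add: cinner_self norm_gp norm_gm)

text \<open>Decompose \<open>(A* + i) f\<close> along the range of \<open>A + i\<close> and
  \<open>N i\<close>. Since \<open>(A* + i) gp = 2 i gp\<close>, the part in \<open>N i\<close> is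
  the image of a multiple of \<open>gp\<close>; after subtracting it and \<open>f0\<close>, what
  remains of \<open>f\<close> is killed by \<open>A* + i\<close>.\<close>

theorem von_Neumann_decomposition:
  assumes f: "f \<in> Hp"
  obtains f0 c d where "f0 \<in> Domain A" "f = f0 + c *\<^sub>C gp + d *\<^sub>C gm"
proof -
  obtain f0 r where f0: "f0 \<in> Domain A" "r \<in> N \<i>"
    and eq: "Astar f + \<i> *\<^sub>C f = Astar f0 + \<i> *\<^sub>C f0 + r"
    using range_shift_decomposition[of "Astar f + \<i> *\<^sub>C f"] by metis
  obtain c where c: "r = c *\<^sub>C gp" using N_spanned f0(2) by blast
  define c' where "c' = c / (2 * \<i>)"
  define u where "u = f - f0 - c' *\<^sub>C gp"
  have f0p: "f0 \<in> Hp" by (rule Domain_A_subset[OF f0(1)])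
  have c2: "c = c' * \<i> + c' * \<i>" by (simp add: c'_def field_simps)
  have "Astar u + \<i> *\<^sub>C u = 0"
  proof -
    have "Astar u = Astar f - Astar f0 - c' *\<^sub>C \<i> *\<^sub>C gp"
      using f f0p by (simp add: u_def)
    moreover have "\<i> *\<^sub>C u = \<i> *\<^sub>C f - \<i> *\<^sub>C f0 - (c' * \<i>) *\<^sub>C gp"
      by (simp add: u_def complex_vector.scale_right_diff_distrib scaleC_scaleC mult.commute)
    moreover have "r = (c' * \<i>) *\<^sub>C gp + (c' * \<i>) *\<^sub>C gp"
      unfolding c c2 scaleC_add_left ..
    moreover have "Astar f = Astar f0 + \<i> *\<^sub>C f0 + r - \<i> *\<^sub>C f"
      using eq by (simp add: eq_diff_eq)
    ultimately show ?thesis by (simp add: scaleC_scaleC)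
  qed
  then have "u \<in> N (-\<i>)"
    using f f0p by (simp add: N_iff u_def eq_neg_iff_add_eq_0)
  then obtain d where "u = d *\<^sub>C gm" using N_spanned by blast
  then have "f = f0 + c' *\<^sub>C gp + d *\<^sub>C gm" by (simp add: u_def algebra_simps)
  then show ?thesis using that f0(1) by blast
qed

lemma bform_coordinates:
  assumes "f0 \<in> Domain A" "f = f0 + c *\<^sub>C gp + d *\<^sub>C gm"
  shows "bform f gp = 2 * \<i> * c" "bform f gm = - 2 * \<i> * d"
  using assms Domain_A_subset[OF assms(1)] by (auto simp: bform_linear bform_Domain)

lemma Domain_A_iff:
  "f \<in> Domain A \<longleftrightarrow> f \<in> Hp \<and> bform f gp = 0 \<and> bform f gm = 0"
proof
  assume *: "f \<in> Hp \<and> bform f gp = 0 \<and> bform f gm = 0"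
  then obtain f0 c d where f0: "f0 \<in> Domain A" "f = f0 + c *\<^sub>C gp + d *\<^sub>C gm"
    using von_Neumann_decomposition by blast
  with * bform_coordinates[OF f0] show "f \<in> Domain A" by simp
qed (auto simp: bform_Domain Domain_A_subset)

text \<open>In the coordinates of \<open>bform_coordinates\<close> the boundary form is diagonal
  with signs \<open>+\<close> on \<open>gp\<close> and \<open>-\<close> on \<open>gm\<close>.
  Expressing the coordinates through the form itself avoids carrying decompositions around.\<close>

lemma bform_expand:
  assumes "f \<in> Hp" "g \<in> Hp"
  shows "2 * bform f g = \<i> * (bform f gp * cnj (bform g gp) - bform f gm * cnj (bform g gm))"
proof -
  obtain f0 c d where f0: "f0 \<in> Domain A" "f = f0 + c *\<^sub>C gp + d *\<^sub>C gm"
    using von_Neumann_decomposition assms(1) by blast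
  have "bform f g = c * bform gp g + d * bform gm g"
    using f0 Domain_A_subset[OF f0(1)] assms(2) by (simp add: bform_linear bform_Domain)
  also have "\<dots> = - c * cnj (bform g gp) - d * cnj (bform g gm)"
    using bform_commute[of gp g] bform_commute[of gm g] by simp
  finally have eq: "bform f g = \<dots>" .
  show ?thesis by (simp add: eq bform_coordinates[OF f0] algebra_simps)
qed

end

context symmetric_1_1
begin

lemma norm_le_plus_norm: "norm f \<le> plus_norm A f" "norm (Astar f) \<le> plus_norm A f"
  by (auto simp: plus_norm_def plus_inner_def cinner_self intro!: real_le_rsqrt)

lemma plus_norm_nonneg [simp]: "0 \<le> plus_norm A f"
  using norm_le_plus_norm(1)[of f] norm_ge_zero order_trans by blast

text \<open>For fixed \<open>g\<close> this is continuity in the plus norm; \<open>G_bounded\<close>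
  applies it after writing boundary functionals as \<open>bform\<close> against fixed
  vectors.\<close>

lemma bform_bounded: "cmod (bform f g) \<le> (norm g + norm (Astar g)) * plus_norm A f"
proof -
  have "cmod (bform f g) \<le> norm (Astar f) * norm g + norm f * norm (Astar g)"
    unfolding bform_def using norm_triangle_ineq4 cinner_Cauchy_Schwarz
    by (meson add_mono order_trans)
  also have "\<dots> \<le> plus_norm A f * norm g + plus_norm A f * norm (Astar g)"
    using norm_le_plus_norm by (intro add_mono mult_right_mono) auto
  finally show ?thesis by (simp add: algebra_simps)
qed

lemma deficiency_pair_exists:
  obtains gp gm where "deficiency_pair A gp gm"
  using deficiency_vectors admissible
  unfolding deficiency_pair_def deficiency_pair_axioms_def symmetric_1_1_def by metis

end

section \<open>Boundary triples\<close>

locale boundary_triple = symmetric_1_1 A for A :: "'h::complex_hilbert operator" +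
  fixes G0 G1 :: "'h \<Rightarrow> complex"
  assumes G0_add: "f \<in> Hp \<Longrightarrow> g \<in> Hp \<Longrightarrow> G0 (f + g) = G0 f + G0 g"
    and G0_scale: "f \<in> Hp \<Longrightarrow> G0 (c *\<^sub>C f) = c * G0 f"
    and G1_add: "f \<in> Hp \<Longrightarrow> g \<in> Hp \<Longrightarrow> G1 (f + g) = G1 f + G1 g"
    and G1_scale: "f \<in> Hp \<Longrightarrow> G1 (c *\<^sub>C f) = c * G1 f"
    and green: "f \<in> Hp \<Longrightarrow> g \<in> Hp \<Longrightarrow> bform f g = cnj (G0 g) * G1 f - G0 f * cnj (G1 g)"
begin

lemmas G_simps [simp] = G0_add G0_scale G1_add G1_scale

lemma G_diff [simp]:
  assumes "f \<in> Hp" "g \<in> Hp"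
  shows "G0 (f - g) = G0 f - G0 g" "G1 (f - g) = G1 f - G1 g"
  using assms G0_add[of "f - g" g] G1_add[of "f - g" g] by simp_all

text \<open>Surjectivity of \<open>(G0, G1)\<close> follows from the Green identity: on
  \<open>gp\<close>, \<open>gm\<close> it prescribes the nondegenerate form with values
  \<open>2 i\<close> and \<open>-2 i\<close>, so the matrix of boundary values of the two vectors is
  invertible.\<close>

lemma boundary_values:
  obtains f where "f \<in> Hp" "G0 f = x" "G1 f = y"
proof -
  obtain gp gm where "deficiency_pair A gp gm" by (rule deficiency_pair_exists)
  then interpret deficiency_pair A gp gm .
  define p p' q q' where "p = G0 gp" "p' = G1 gp" "q = G0 gm" "q' = G1 gm"
  note pq = this
  have e: "cnj p * p' - p * cnj p' = 2 * \<i>" "cnj q * q' - q * cnj q' = - 2 * \<i>"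
    "cnj q * p' - p * cnj q' = 0" "cnj p * q' - q * cnj p' = 0"
    using green[of gp gp] green[of gm gm] green[of gp gm] green[of gm gp] by (simp_all add: pq)
  define D where "D = p * q' - p' * q"
  \<comment> \<open>The squared modulus of the determinant is a polynomial in the four Green
    expressions evaluated in \<open>e\<close>.\<close>
  have "D * cnj D = (cnj p * q' - q * cnj p') * (p * cnj q' - cnj q * p')
      + (cnj p * p' - p * cnj p') * (cnj q * q' - q * cnj q')"
    by (simp add: D_def algebra_simps)
  also have "\<dots> = 4" unfolding e by simp
  finally have D: "D \<noteq> 0" by auto
  \<comment> \<open>Cramer's rule for the coordinates along \<open>gp\<close> and
    \<open>gm\<close>.\<close>
  define f where "f = ((x * q' - y * q) / D) *\<^sub>C gp + ((y * p - x * p') / D) *\<^sub>C gm"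
  have "G0 f = ((x * q' - y * q) * p + (y * p - x * p') * q) / D"
    by (simp add: f_def pq[symmetric] add_divide_distrib)
  also have "\<dots> = x" using D by (simp add: D_def divide_eq_eq) (simp add: algebra_simps)
  finally have "G0 f = x" .
  have "G1 f = ((x * q' - y * q) * p' + (y * p - x * p') * q') / D"
    by (simp add: f_def pq[symmetric] add_divide_distrib)
  also have "\<dots> = y" using D by (simp add: D_def divide_eq_eq) (simp add: algebra_simps)
  finally have "G1 f = y" .
  moreover have "f \<in> Hp" by (simp add: f_def)
  ultimately show ?thesis using that \<open>G0 f = x\<close> by blast
qed

lemma Domain_A_boundary: "f \<in> Domain A \<longleftrightarrow> f \<in> Hp \<and> G0 f = 0 \<and> G1 f = 0"
proof
  assume f: "f \<in> Domain A"
  have fp: "f \<in> Hp" by (rule Domain_A_subset[OF f])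
  obtain e0 e1 where e: "e0 \<in> Hp" "G0 e0 = 1" "G1 e0 = 0" "e1 \<in> Hp" "G0 e1 = 0" "G1 e1 = 1"
    using boundary_values by metis
  show "f \<in> Hp \<and> G0 f = 0 \<and> G1 f = 0"
    using green[OF fp e(1)] green[OF fp e(4)] bform_Domain[OF f e(1)] bform_Domain[OF f e(4)] fp e
    by simp
next
  assume f: "f \<in> Hp \<and> G0 f = 0 \<and> G1 f = 0"
  obtain gp gm where "deficiency_pair A gp gm" by (rule deficiency_pair_exists)
  then interpret deficiency_pair A gp gm .
  show "f \<in> Domain A" unfolding Domain_A_iff using f by (simp add: green)
qed

text \<open>Pairing with vectors of boundary values \<open>(1, 0)\<close> and \<open>(0, 1)\<close>
  in the Green identity turns \<open>G1 f\<close> and \<open>- G0 f\<close> into values of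
  \<open>bform f\<close>.\<close>

lemma G_bounded:
  obtains C where "0 \<le> C" "\<And>f. f \<in> Hp \<Longrightarrow> cmod (G0 f) \<le> C * plus_norm A f"
    "\<And>f. f \<in> Hp \<Longrightarrow> cmod (G1 f) \<le> C * plus_norm A f"
proof -
  obtain e0 e1 where e: "e0 \<in> Hp" "G0 e0 = 1" "G1 e0 = 0" "e1 \<in> Hp" "G0 e1 = 0" "G1 e1 = 1"
    using boundary_values by metis
  define C where "C = (norm e0 + norm (Astar e0)) + (norm e1 + norm (Astar e1))"
  have C: "0 \<le> C" "norm e0 + norm (Astar e0) \<le> C" "norm e1 + norm (Astar e1) \<le> C"
    by (simp_all add: C_def)
  show ?thesis
  proof
    fix f assume f: "f \<in> Hp"
    show "cmod (G1 f) \<le> C * plus_norm A f"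
      using bform_bounded[of f e0] green[OF f e(1)] mult_right_mono[OF C(2) plus_norm_nonneg[of f]] e
      by simp
    show "cmod (G0 f) \<le> C * plus_norm A f"
      using bform_bounded[of f e1] green[OF f e(4)] mult_right_mono[OF C(3) plus_norm_nonneg[of f]] e
      by simp
  qed (rule C(1))
qed

section \<open>Extensions of \<open>A\<close> cut out by one linear boundary condition\<close>

definition bker :: "complex \<Rightarrow> complex \<Rightarrow> 'h operator" where
  "bker c d = {(f, Astar f) | f. f \<in> Hp \<and> c * G0 f + d * G1 f = 0}"

lemma bker_iff: "(f, g) \<in> bker c d \<longleftrightarrow> f \<in> Hp \<and> g = Astar f \<and> c * G0 f + d * G1 f = 0"
  by (auto simp: bker_def)

lemma G_zero [simp]: "G0 0 = 0" "G1 0 = 0"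
  using G0_scale[of 0 0] G1_scale[of 0 0] by simp_all

lemma Domain_bker: "f \<in> Domain (bker c d) \<longleftrightarrow> f \<in> Hp \<and> c * G0 f + d * G1 f = 0"
  by (simp add: Domain_iff bker_iff)

lemma bker_linear: "linear_operator (bker c d)"
  unfolding linear_operator_def
proof (intro conjI allI impI)
  show "single_valued (bker c d)" by (rule single_valuedI) (simp add: bker_iff)
  show "(0, 0) \<in> bker c d" by (simp add: bker_iff)
next
  fix x y x' y' assume "(x, y) \<in> bker c d" "(x', y') \<in> bker c d"
  then have "x \<in> Hp" "y = Astar x" "x' \<in> Hp" "y' = Astar x'" 
    "(c * G0 x + d * G1 x) + (c * G0 x' + d * G1 x') = 0"
    by (simp_all add: bker_iff)
  then show "(x + x', y + y') \<in> bker c d" by (simp add: bker_iff algebra_simps)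
next
  fix e x y assume "(x, y) \<in> bker c d"
  then have "x \<in> Hp" "y = Astar x" "e * (c * G0 x + d * G1 x) = 0" by (simp_all add: bker_iff)
  then show "(e *\<^sub>C x, e *\<^sub>C y) \<in> bker c d" by (simp add: bker_iff algebra_simps)
qed

lemma A_subset_bker: "A \<subseteq> bker c d"
  using A_iff Domain_A_boundary by (auto simp: bker_iff)

lemma bker_subset: "bker c d \<subseteq> adjoint_op A"
  by (auto simp: bker_iff adjoint_iff)

lemma adjoint_bker:
  assumes "c \<noteq> 0 \<or> d \<noteq> 0"
  shows "adjoint_op (bker c d) = bker (cnj c) (cnj d)"
proof (intro set_eqI iffI; clarify)
  fix g h assume gh: "(g, h) \<in> adjoint_op (bker c d)"
  then have g: "g \<in> Hp" "h = Astar g"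
    using subsetD[OF adjoint_op_antimono[OF A_subset_bker] gh] by (simp_all add: adjoint_iff)
  \<comment> \<open>The pair \<open>(-d, c)\<close> spans the boundary values allowed by the
    condition, so testing against this single vector yields the adjoint condition.\<close>
  obtain f where f: "f \<in> Hp" "G0 f = - d" "G1 f = c" using boundary_values by metis
  then have "(f, Astar f) \<in> bker c d" by (simp add: bker_iff)
  then have "bform f g = 0"
    using adjoint_opD[OF gh] by (simp add: bform_def g)
  then have "cnj (G0 g) * c + d * cnj (G1 g) = 0" using green[OF f(1) g(1)] f by simp
  then have "cnj (cnj (G0 g) * c + d * cnj (G1 g)) = 0" by (simp only: complex_cnj_zero)
  then show "(g, h) \<in> bker (cnj c) (cnj d)" using g by (simp add: bker_iff mult.commute)
next
  fix g h assume "(g, h) \<in> bker (cnj c) (cnj d)"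
  then have g: "g \<in> Hp" "h = Astar g" "cnj c * G0 g + cnj d * G1 g = 0" by (auto simp: bker_iff)
  have "cnj (cnj c * G0 g + cnj d * G1 g) = 0" by (simp only: g(3) complex_cnj_zero)
  then have g3: "c * cnj (G0 g) + d * cnj (G1 g) = 0"
    by (simp only: complex_cnj_add complex_cnj_mult complex_cnj_cnj)
  show "(g, h) \<in> adjoint_op (bker c d)"
  proof (rule adjoint_opI)
    fix f k assume "(f, k) \<in> bker c d"
    then have f: "f \<in> Hp" "k = Astar f" "c * G0 f + d * G1 f = 0" by (auto simp: bker_iff)
    \<comment> \<open>Only one of \<open>c\<close>, \<open>d\<close> is known to be nonzero, hence
      the form is computed after multiplication by each of them.\<close>
    have "c * bform f g = G1 f * (c * cnj (G0 g) + d * cnj (G1 g)) - cnj (G1 g) * (c * G0 f + d * G1 f)"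
      "d * bform f g = cnj (G0 g) * (c * G0 f + d * G1 f) - G0 f * (c * cnj (G0 g) + d * cnj (G1 g))"
      by (simp_all add: green[OF f(1) g(1)] algebra_simps)
    then have "bform f g = 0" using g3 f(3) assms by auto
    then show "cinner k g = cinner f h" by (simp add: bform_def f g)
  qed
qed


lemma bker_self_adjoint: "self_adjoint (bker 1 0)"
proof -
  have "closure (Domain A) \<subseteq> closure (Domain (bker 1 0))"
    using A_subset_bker by (intro closure_mono) blast
  then show ?thesis
    using dense_A adjoint_bker[of 1 0]
    by (auto simp: self_adjoint_def bker_linear densely_defined_def)
qed

lemma bker_dissipative:
  assumes "(f, g) \<in> bker 1 \<i>"
  shows "bform f f = 2 * \<i> * complex_of_real ((cmod (G1 f))\<^sup>2)"
proof -
  have f: "f \<in> Hp" "G0 f = - \<i> * G1 f"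
    using assms by (auto simp: bker_iff eq_neg_iff_add_eq_0)
  show ?thesis by (simp only: green[OF f(1) f(1)] f(2) complex_norm_square) simp
qed

text \<open>Dissipativity gives \<open>(g, f)\<close> a nonnegative imaginary part, so the cross
  term in the square of the right-hand norm is nonnegative. This bounds the resolvent at
  \<open>-i\<close>.\<close>

lemma bker_norm_le:
  assumes "(f, g) \<in> bker 1 \<i>"
  shows "norm f \<le> norm (g + \<i> *\<^sub>C f)"
proof -
  have g: "g = Astar f" using assms by (simp add: bker_iff)
  have "cinner g f - cnj (cinner g f) = 2 * \<i> * complex_of_real ((cmod (G1 f))\<^sup>2)"
    using bker_dissipative[OF assms] cinner_commute[of f g] by (simp add: bform_def g)
  then have "0 \<le> Im (cinner g f)" by (simp add: complex_eq_iff del: of_real_power)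
  then have "(norm f)\<^sup>2 \<le> (norm (g + \<i> *\<^sub>C f))\<^sup>2"
    by (simp add: norm_add_square norm_scaleC cinner_distribs)
  then show ?thesis by (rule power2_le_imp_le) simp
qed

text \<open>Injectivity and the bound come from dissipativity. For surjectivity, the range of
  \<open>A + i\<close> misses only \<open>N i\<close>, so one domain vector \<open>t\<close> sent by
  \<open>A* + i\<close> to a multiple of \<open>gp\<close> suffices. It exists because
  \<open>gm\<close> violates the boundary condition: its boundary form has the wrong sign.\<close>

lemma bker_resolvent_set: "- \<i> \<in> resolvent_set (bker 1 \<i>)"
proof -
  obtain gp gm where "deficiency_pair A gp gm" by (rule deficiency_pair_exists)
  then interpret deficiency_pair A gp gm .
  have "G0 gm + \<i> * G1 gm \<noteq> 0"
  proof
    assume "G0 gm + \<i> * G1 gm = 0"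
    then have "(gm, Astar gm) \<in> bker 1 \<i>" by (simp add: bker_iff)
    from arg_cong[OF bker_dissipative[OF this], of Im] have "(cmod (G1 gm))\<^sup>2 = -1"
      by (simp del: of_real_power)
    then show False using zero_le_power2[of "cmod (G1 gm)"] by simp
  qed
  then obtain w where w: "G0 gp + \<i> * G1 gp = w * (G0 gm + \<i> * G1 gm)"
    by (metis nonzero_eq_divide_eq)
  \<comment> \<open>This \<open>w\<close> makes \<open>t\<close> satisfy the boundary condition, and
    \<open>(A* + i) gm = 0\<close> leaves \<open>(A* + i) t = 2 i gp\<close>.\<close>
  define t where "t = gp - w *\<^sub>C gm"
  have tp: "t \<in> Hp" by (simp add: t_def)
  have "G0 t + \<i> * G1 t = (G0 gp + \<i> * G1 gp) - w * (G0 gm + \<i> * G1 gm)"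
    by (simp add: t_def algebra_simps)
  then have t: "(t, Astar t) \<in> bker 1 \<i>" using tp by (simp add: bker_iff w)
  have "(2 * \<i>) *\<^sub>C gp = \<i> *\<^sub>C gp + \<i> *\<^sub>C gp"
    by (simp only: scaleC_add_left[symmetric] mult_2)
  then have At: "Astar t + \<i> *\<^sub>C t = (2 * \<i>) *\<^sub>C gp"
    by (simp add: t_def complex_vector.scale_right_diff_distrib scaleC_scaleC mult.commute[of w])
  have surj: "\<exists>f. (f, h + (- \<i>) *\<^sub>C f) \<in> bker 1 \<i>" for h
  proof -
    obtain f r where f: "f \<in> Domain A" "r \<in> N \<i>" "h = Astar f + \<i> *\<^sub>C f + r"
      by (rule range_shift_decomposition)
    obtain c where c: "r = c *\<^sub>C gp" using N_spanned f(2) by blast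
    define d where "d = c / (2 * \<i>)"
    have d: "d * (2 * \<i>) = c" by (simp add: d_def field_simps)
    define u where "u = f + d *\<^sub>C t"
    have fp: "f \<in> Hp" by (rule Domain_A_subset[OF f(1)])
    have "(f, Astar f) \<in> bker 1 \<i>" using f(1) A_iff[of f "Astar f"] A_subset_bker by blast
    then have u: "(u, Astar u) \<in> bker 1 \<i>"
      using linear_operator_add[OF bker_linear _ linear_operator_scale[OF bker_linear t], of f "Astar f" d]
      by (simp add: u_def tp fp)
    have "Astar u + \<i> *\<^sub>C u = (Astar f + \<i> *\<^sub>C f) + d *\<^sub>C (Astar t + \<i> *\<^sub>C t)"
      by (simp add: u_def tp fp scaleC_add_right complex_vector.scale_left_commute)
    also have "\<dots> = h" by (simp only: At f(3) c scaleC_scaleC d)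
    finally have "Astar u = h + (- \<i>) *\<^sub>C u" by (simp add: eq_diff_eq)
    then show ?thesis using u by metis
  qed
  have "f = f'" if "(f, h + (- \<i>) *\<^sub>C f) \<in> bker 1 \<i>" "(f', h + (- \<i>) *\<^sub>C f') \<in> bker 1 \<i>" for f f' h
    using bker_norm_le[OF linear_operator_diff[OF bker_linear that]]
    by (simp add: complex_vector.scale_right_diff_distrib)
  with surj have "\<exists>!f. (f, h + (- \<i>) *\<^sub>C f) \<in> bker 1 \<i>" for h by blast
  moreover have "\<forall>(f, g) \<in> bker 1 \<i>. norm f \<le> 1 * norm (g - (- \<i>) *\<^sub>C f)"
    using bker_norm_le by auto
  ultimately show ?thesis unfolding resolvent_set_def by blast
qed

lemma bker_not_symmetric: "\<not> symmetric_op (bker 1 \<i>)"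
proof
  assume sym: "symmetric_op (bker 1 \<i>)"
  obtain f where f: "f \<in> Hp" "G0 f = - \<i>" "G1 f = 1" by (rule boundary_values)
  then have "(f, Astar f) \<in> bker 1 \<i>" by (simp add: bker_iff)
  moreover from this have "(f, Astar f) \<in> adjoint_op (bker 1 \<i>)"
    using sym by (auto simp: symmetric_op_def)
  ultimately show False using f by (simp add: adjoint_bker bker_iff)
qed

lemma bker_main_operator: "main_operator A (bker 1 \<i>)"
proof -
  have zero: "x = 0 \<and> y = 0" if "x + \<i> * y = 0" "x - \<i> * y = 0" for x y :: complex
  proof -
    have "2 * x = 0" using that by algebra
    with that show ?thesis by simp
  qed
  have "f \<in> Domain A \<longleftrightarrow> f \<in> Domain (bker 1 \<i>) \<inter> Domain (adjoint_op (bker 1 \<i>))" for f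
    unfolding Domain_A_boundary using zero[of "G0 f" "G1 f"] by (auto simp: adjoint_bker Domain_bker)
  then have "Domain A = Domain (bker 1 \<i>) \<inter> Domain (adjoint_op (bker 1 \<i>))" by blast
  then show ?thesis
    unfolding main_operator_def
    using bker_linear bker_not_symmetric A_subset_bker bker_subset bker_resolvent_set by blast
qed

text \<open>The functional \<open>h + x \<chi>\<close> on the positive space, with channel vector \<open>\<chi> = cnj G1\<close>.\<close>

definition minus_vec :: "'h \<Rightarrow> complex \<Rightarrow> 'h \<Rightarrow> complex" where
  "minus_vec h x = (\<lambda>g. if g \<in> Hp then cinner h g + x * cnj (G1 g) else 0)"

text \<open>On the dense set \<open>Domain A\<close> the channel vector vanishes, which determines
  \<open>h\<close>; a vector with \<open>G1 e = 1\<close> then determines \<open>x\<close>. In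
  particular the channel vector is not in the Hilbert space.\<close>

lemma minus_vec_inject: "minus_vec h x = minus_vec h' x' \<longleftrightarrow> h = h' \<and> x = x'"
proof
  assume eq: "minus_vec h x = minus_vec h' x'"
  have *: "cinner h g + x * cnj (G1 g) = cinner h' g + x' * cnj (G1 g)" if "g \<in> Hp" for g
    using fun_cong[OF eq, of g] that by (simp add: minus_vec_def)
  have "h - h' = 0"
  proof (rule orthogonal_dense_eq_0)
    show "closure (Domain A) = UNIV" using dense_A by (simp add: densely_defined_def)
    fix f assume "f \<in> Domain A"
    then have "cinner (h - h') f = 0" using *[of f] by (simp add: Domain_A_boundary cinner_diff_left)
    then show "cinner f (h - h') = 0" by (subst cinner_commute) simp
  qed
  moreover obtain e where "e \<in> Hp" "G0 e = 0" "G1 e = 1" by (rule boundary_values)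
  ultimately show "h = h' \<and> x = x'" using *[of e] by simp
qed simp

lemma embed_minus_vec: "embed A h = minus_vec h 0"
  by (auto simp: embed_def minus_vec_def)

lemma minus_vec_bounds:
  obtains C where "0 \<le> C" "\<And>f. f \<in> Hp \<Longrightarrow> cmod (G0 f) \<le> C * plus_norm A f"
    "\<And>f. f \<in> Hp \<Longrightarrow> cmod (G1 f) \<le> C * plus_norm A f"
    "\<And>h x f. f \<in> Hp \<Longrightarrow> cmod (minus_vec h x f) \<le> (norm h + C * cmod x) * plus_norm A f"
    "\<And>h x. minus_norm A (minus_vec h x) \<le> norm h + C * cmod x"
proof -
  obtain C where C: "0 \<le> C" "\<And>f. f \<in> Hp \<Longrightarrow> cmod (G0 f) \<le> C * plus_norm A f"
    "\<And>f. f \<in> Hp \<Longrightarrow> cmod (G1 f) \<le> C * plus_norm A f" using G_bounded by metis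
  have *: "cmod (minus_vec h x f) \<le> (norm h + C * cmod x) * plus_norm A f" if f: "f \<in> Hp" for h x f
  proof -
    have "cmod (minus_vec h x f) \<le> cmod (cinner h f) + cmod x * cmod (G1 f)"
      using f norm_triangle_ineq[of "cinner h f" "x * cnj (G1 f)"] by (simp add: minus_vec_def norm_mult)
    also have "cmod (cinner h f) \<le> norm h * plus_norm A f"
      using cinner_Cauchy_Schwarz norm_le_plus_norm(1) by (meson mult_left_mono norm_ge_zero order_trans)
    also have "cmod x * cmod (G1 f) \<le> cmod x * (C * plus_norm A f)"
      using C(3)[OF f] by (intro mult_left_mono) auto
    finally show ?thesis by (simp add: algebra_simps)
  qed
  have "minus_norm A (minus_vec h x) \<le> norm h + C * cmod x" for h x
    unfolding minus_norm_def
  proof (rule cSUP_least)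
    have "plus_norm A 0 \<le> 1" by (simp add: plus_norm_def plus_inner_def)
    then show "{f \<in> Hp. plus_norm A f \<le> 1} \<noteq> {}" using Astar_zero by blast
    fix f assume f: "f \<in> {f \<in> Hp. plus_norm A f \<le> 1}"
    have "(norm h + C * cmod x) * plus_norm A f \<le> (norm h + C * cmod x) * 1"
      using f C(1) by (intro mult_left_mono) auto
    with *[of f h x] f show "cmod (minus_vec h x f) \<le> norm h + C * cmod x" by simp
  qed
  then show ?thesis using that C * by blast
qed

lemma minus_vec_in_minus_space: "minus_vec h x \<in> minus_space A"
proof -
  obtain C where "\<And>f. f \<in> Hp \<Longrightarrow> cmod (minus_vec h x f) \<le> (norm h + C * cmod x) * plus_norm A f"
    using minus_vec_bounds by metis
  then have "\<exists>C. \<forall>f\<in>Hp. cmod (minus_vec h x f) \<le> C * plus_norm A f" by blast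
  moreover have "minus_vec h x (f + g) = minus_vec h x f + minus_vec h x g" if "f \<in> Hp" "g \<in> Hp" for f g
    using that by (simp add: minus_vec_def cinner_distribs algebra_simps)
  moreover have "minus_vec h x (c *\<^sub>C f) = cnj c * minus_vec h x f" if "f \<in> Hp" for c f
    using that by (simp add: minus_vec_def cinner_distribs algebra_simps)
  moreover have "minus_vec h x f = 0" if "f \<notin> Hp" for f
    using that by (simp add: minus_vec_def)
  ultimately show ?thesis unfolding minus_space_def by simp
qed


section \<open>The L-system of a boundary triple and its impedance function\<close>

definition triple_state :: "'h \<Rightarrow> 'h \<Rightarrow> complex" where
  "triple_state f = minus_vec (Astar f) (G0 f + \<i> * G1 f)"

definition triple_channel :: "complex \<Rightarrow> 'h \<Rightarrow> complex" where
  "triple_channel = minus_vec 0"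

lemma minus_vec_add: "(\<lambda>g. minus_vec h x g + minus_vec h' x' g) = minus_vec (h + h') (x + x')"
  by (auto simp: minus_vec_def cinner_add_left algebra_simps)

lemma minus_vec_scale: "(\<lambda>g. c * minus_vec h x g) = minus_vec (c *\<^sub>C h) (c * x)"
  by (auto simp: minus_vec_def cinner_scaleC_left algebra_simps)

text \<open>By the Green identity, exchanging the arguments only flips the sign of the
  \<open>G1\<close> term. The operator \<open>X\<close> is kept general because a given state
  operator is determined only on the positive space.\<close>

lemma adj_pm_triple:
  assumes X: "\<And>f. f \<in> Hp \<Longrightarrow> X f = triple_state f" and f: "f \<in> Hp"
  shows "adj_pm A X f = minus_vec (Astar f) (G0 f - \<i> * G1 f)"
proof
  fix g
  show "adj_pm A X f g = minus_vec (Astar f) (G0 f - \<i> * G1 f) g"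
  proof (cases "g \<in> Hp")
    case True
    have "cnj (cinner (Astar g) f) = cinner (Astar f) g - bform f g"
      using cinner_commute[of f "Astar g"] by (simp add: bform_def)
    then show ?thesis using True f green[OF f True]
      by (simp add: adj_pm_def X triple_state_def minus_vec_def algebra_simps)
  qed (simp add: adj_pm_def minus_vec_def)
qed

lemma re_pm_triple:
  assumes "\<And>f. f \<in> Hp \<Longrightarrow> X f = triple_state f" and "f \<in> Hp"
  shows "re_pm A X f = minus_vec (Astar f) (G0 f)"
  using assms by (auto simp: re_pm_def adj_pm_triple triple_state_def minus_vec_def field_simps)

lemma im_pm_triple:
  assumes "\<And>f. f \<in> Hp \<Longrightarrow> X f = triple_state f" and "f \<in> Hp"
  shows "im_pm A X f = triple_channel (G1 f)"
  using assms
  by (auto simp: im_pm_def adj_pm_triple triple_state_def triple_channel_def minus_vec_def field_simps)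

lemma quasi_kernel_triple:
  assumes "\<And>f. f \<in> Hp \<Longrightarrow> X f = triple_state f"
  shows "quasi_kernel A (re_pm A X) = bker 1 0"
  using re_pm_triple[OF assms]
  by (auto simp: quasi_kernel_def bker_iff embed_minus_vec minus_vec_inject)

lemma adj_K_triple: "f \<in> Hp \<Longrightarrow> adj_K triple_channel f = G1 f"
  by (simp add: adj_K_def triple_channel_def minus_vec_def)

lemma bounded_triple_state: "bounded_plus_minus A triple_state"
proof -
  obtain C where C: "0 \<le> C" "\<And>f. f \<in> Hp \<Longrightarrow> cmod (G0 f) \<le> C * plus_norm A f"
    "\<And>f. f \<in> Hp \<Longrightarrow> cmod (G1 f) \<le> C * plus_norm A f"
    "\<And>h x. minus_norm A (minus_vec h x) \<le> norm h + C * cmod x" by (metis minus_vec_bounds)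
  have "minus_norm A (triple_state f) \<le> (1 + C * (C + C)) * plus_norm A f" if f: "f \<in> Hp" for f
  proof -
    have "cmod (G0 f + \<i> * G1 f) \<le> C * plus_norm A f + C * plus_norm A f"
      using norm_triangle_ineq[of "G0 f" "\<i> * G1 f"] C(2)[OF f] C(3)[OF f] by (simp add: norm_mult)
    then have "C * cmod (G0 f + \<i> * G1 f) \<le> C * (C * plus_norm A f + C * plus_norm A f)"
      using C(1) by (rule mult_left_mono)
    with C(4)[of "Astar f" "G0 f + \<i> * G1 f"] norm_le_plus_norm(2)[of f] show ?thesis
      by (simp add: triple_state_def algebra_simps)
  qed
  moreover have "triple_state (f + g) = (\<lambda>k. triple_state f k + triple_state g k)"
    if "f \<in> Hp" "g \<in> Hp" for f g
    using that by (simp add: triple_state_def minus_vec_add algebra_simps)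
  moreover have "triple_state (c *\<^sub>C f) = (\<lambda>k. c * triple_state f k)" if "f \<in> Hp" for c f
    using that by (simp add: triple_state_def minus_vec_scale algebra_simps)
  moreover have "triple_state f \<in> minus_space A" for f
    unfolding triple_state_def by (rule minus_vec_in_minus_space)
  ultimately show ?thesis unfolding bounded_plus_minus_def by blast
qed

lemma bounded_triple_channel: "bounded_C_minus A triple_channel"
proof -
  obtain C where C: "\<And>h x. minus_norm A (minus_vec h x) \<le> norm h + C * cmod x"
    by (metis minus_vec_bounds)
  have "triple_channel c \<in> minus_space A" for c
    unfolding triple_channel_def by (rule minus_vec_in_minus_space)
  moreover have "triple_channel (c + d) = (\<lambda>f. triple_channel c f + triple_channel d f)"
    "triple_channel (c * d) = (\<lambda>f. c * triple_channel d f)" for c d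
    by (simp_all add: triple_channel_def minus_vec_add minus_vec_scale)
  moreover have "minus_norm A (triple_channel c) \<le> C * cmod c" for c
    using C[of 0 c] by (simp add: triple_channel_def)
  ultimately show ?thesis unfolding bounded_C_minus_def by blast
qed

lemma star_extension_triple: "star_extension A (bker 1 \<i>) triple_state"
proof -
  have "extends_to_pm A (bker 1 \<i>) triple_state"
    by (auto simp: extends_to_pm_def bker_iff triple_state_def embed_minus_vec)
  moreover have "adjoint_op (bker 1 \<i>) = bker 1 (-\<i>)" by (simp add: adjoint_bker)
  moreover have "extends_to_pm A (bker 1 (-\<i>)) (adj_pm A triple_state)"
    by (auto simp: extends_to_pm_def bker_iff adj_pm_triple embed_minus_vec)
  ultimately show ?thesis
    using bounded_triple_state A_subset_bker bker_self_adjoint quasi_kernel_triple[of triple_state]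
    by (simp add: star_extension_def)
qed

definition triple_system :: "'h lsystem" where
  "triple_system = \<lparr>sym_op = A, main_op = bker 1 \<i>, state_op = triple_state, channel = triple_channel\<rparr>"

lemma triple_system_simps [simp]:
  "sym_op triple_system = A" "main_op triple_system = bker 1 \<i>"
  "state_op triple_system = triple_state" "channel triple_system = triple_channel"
  by (simp_all add: triple_system_def)

theorem L_system_triple: "L_system triple_system"
proof -
  have im: "im_pm A triple_state f = triple_channel (G1 f)" if "f \<in> Hp" for f
    using im_pm_triple[OF refl that] .
  have "range triple_channel = im_pm A triple_state ` Hp"
  proof (intro equalityI subsetI)
    fix \<phi> assume "\<phi> \<in> range triple_channel"
    then obtain c where c: "\<phi> = triple_channel c" by blast
    obtain f where "f \<in> Hp" "G0 f = 0" "G1 f = c" by (rule boundary_values)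
    then show "\<phi> \<in> im_pm A triple_state ` Hp" using im[of f] c by (intro image_eqI[of _ _ f]) simp_all
  qed (auto simp: im)
  then show ?thesis
    unfolding L_system_def
    using admissible bker_main_operator star_extension_triple bounded_triple_channel im adj_K_triple
    by simp
qed

text \<open>By injectivity of \<open>minus_vec\<close>, the equation
  \<open>(Re A - z) u = K 1\<close> splits into \<open>A* u = z u\<close> and
  \<open>G0 u = 1\<close>; the adjoint of the channel then reads off \<open>G1\<close>.\<close>

lemma impedance_triple:
  assumes \<Theta>: "sym_op \<Theta> = A" "\<And>f. f \<in> Hp \<Longrightarrow> state_op \<Theta> f = triple_state f"
      "channel \<Theta> = triple_channel"
    and f: "f \<in> N z" "G0 f = 1"
    and inj: "\<And>f. (f, z *\<^sub>C f) \<in> bker 1 0 \<Longrightarrow> f = 0"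
  shows "impedance \<Theta> z = G1 f"
proof -
  have fN: "f \<in> Hp" "Astar f = z *\<^sub>C f" using f by (auto simp: N_iff)
  have eq: "(\<lambda>g. re_pm A (state_op \<Theta>) u g - z * embed A u g) = channel \<Theta> 1
      \<longleftrightarrow> Astar u = z *\<^sub>C u \<and> G0 u = 1" if u: "u \<in> Hp" for u
  proof -
    have "(\<lambda>g. re_pm A (state_op \<Theta>) u g - z * embed A u g)
        = (\<lambda>g. minus_vec (Astar u) (G0 u) g + minus_vec ((- z) *\<^sub>C u) 0 g)"
      using re_pm_triple[OF \<Theta>(2) u] minus_vec_scale[of "-z" u 0]
      by (auto simp: embed_minus_vec fun_eq_iff)
    then show ?thesis
      by (simp add: minus_vec_add \<Theta>(3) triple_channel_def minus_vec_inject)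
  qed
  have "(THE u. u \<in> Hp \<and> (\<lambda>g. re_pm A (state_op \<Theta>) u g - z * embed A u g) = channel \<Theta> 1) = f"
  proof (rule the_equality)
    show "f \<in> Hp \<and> (\<lambda>g. re_pm A (state_op \<Theta>) f g - z * embed A f g) = channel \<Theta> 1"
      using eq[of f] fN f(2) by simp
    fix u assume "u \<in> Hp \<and> (\<lambda>g. re_pm A (state_op \<Theta>) u g - z * embed A u g) = channel \<Theta> 1"
    then have u: "u \<in> Hp" "Astar u = z *\<^sub>C u" "G0 u = 1" using eq by auto
    have "u - f = 0"
      using u fN f(2) by (intro inj) (simp add: bker_iff complex_vector.scale_right_diff_distrib)
    then show "u = f" by simp
  qed
  then show ?thesis using fN(1) by (simp add: impedance_def \<Theta>(1,3) adj_K_triple)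
qed

text \<open>Start from any \<open>e\<close> with \<open>G0 e = 1\<close> and correct it by the
  solution \<open>u\<close> in the kernel of \<open>G0\<close> of
  \<open>(A* - z) u = (A* - z) e\<close>; the difference is an eigenvector with the same
  \<open>G0\<close>.\<close>

lemma resolvent_set_triple:
  assumes z: "z \<in> resolvent_set (bker 1 0)"
  obtains f where "f \<in> N z" "G0 f = 1" "\<And>f. (f, z *\<^sub>C f) \<in> bker 1 0 \<Longrightarrow> f = 0"
proof -
  have ex: "\<exists>!f. (f, h + z *\<^sub>C f) \<in> bker 1 0" for h
    using z by (simp add: resolvent_set_def)
  have inj: "f = 0" if "(f, z *\<^sub>C f) \<in> bker 1 0" for f
  proof -
    have "(0, 0) \<in> bker 1 0" using bker_linear by (simp add: linear_operator_def)
    then show ?thesis using ex1E[OF ex[of 0]] that by (metis add_0 complex_vector.scale_zero_right)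
  qed
  obtain e where e: "e \<in> Hp" "G0 e = 1" "G1 e = 0" by (rule boundary_values)
  obtain u where "(u, Astar e - z *\<^sub>C e + z *\<^sub>C u) \<in> bker 1 0"
    using ex[of "Astar e - z *\<^sub>C e"] by blast
  then have u: "u \<in> Hp" "Astar e - z *\<^sub>C e + z *\<^sub>C u = Astar u" "G0 u = 0"
    by (simp_all add: bker_iff)
  have "Astar (e - u) = z *\<^sub>C (e - u)"
    using e u(1) by (simp add: u(2)[symmetric] complex_vector.scale_right_diff_distrib)
  then have "e - u \<in> N z" using e u(1) by (simp add: N_iff)
  moreover have "G0 (e - u) = 1" using e u by simp
  ultimately show ?thesis using that inj by blast
qed

text \<open>The two terms added to the Green identity cancel because \<open>Q\<close> is
  real.\<close>

lemma boundary_triple_shift: "boundary_triple A G0 (\<lambda>f. G1 f + complex_of_real Q * G0 f)"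
  by unfold_locales (simp_all add: green algebra_simps)

end

section \<open>From an L-system back to a boundary triple\<close>

context symmetric_1_1
begin

text \<open>\<open>Domain S\<close> is a maximal isotropic subspace for the boundary form. Modulo
  \<open>Domain A\<close> the form has signature (1,1), so the subspace is spanned by a single
  isotropic \<open>s\<close> and equals the orthogonal complement of \<open>s\<close> with respect
  to the form.\<close>

lemma self_adjoint_extension_boundary:
  assumes sa: "self_adjoint S" and AS: "A \<subseteq> S"
  obtains s where "s \<in> Hp" "\<And>f. f \<in> Domain S \<longleftrightarrow> f \<in> Hp \<and> bform f s = 0"
proof -
  obtain gp gm where "deficiency_pair A gp gm" by (rule deficiency_pair_exists)
  then interpret deficiency_pair A gp gm .
  have adj: "adjoint_op S = S" using sa by (simp add: self_adjoint_def)
  have S: "f \<in> Hp \<and> h = Astar f" if "(f, h) \<in> S" for f h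
  proof -
    have "(f, h) \<in> adjoint_op A" using adjoint_op_antimono[OF AS] that adj by blast
    then show ?thesis by (simp add: adjoint_iff)
  qed
  then have S': "(f, Astar f) \<in> S" "f \<in> Hp" if "f \<in> Domain S" for f using that by blast+
  have sym: "bform f g = 0" if "f \<in> Domain S" "g \<in> Domain S" for f g
    using self_adjoint_symmetric[OF sa S'(1)[OF that(1)] S'(1)[OF that(2)]] by (simp add: bform_def)
  have max: "f \<in> Domain S" if f: "f \<in> Hp" and "\<And>g. g \<in> Domain S \<Longrightarrow> bform g f = 0" for f
  proof -
    have "(f, Astar f) \<in> adjoint_op S"
    proof (rule adjoint_opI)
      fix g k assume gk: "(g, k) \<in> S"
      then have "bform g f = 0" using that(2) by blast
      then show "cinner k f = cinner g (Astar f)" using S[OF gk] by (simp add: bform_def)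
    qed
    then show ?thesis unfolding adj by blast
  qed
  \<comment> \<open>Otherwise \<open>gp\<close> would annihilate \<open>Domain S\<close> and belong
    to it by maximality, although \<open>bform gp gp\<close> is not zero.\<close>
  have "\<exists>s\<in>Domain S. s \<notin> Domain A"
  proof (rule ccontr)
    assume "\<not> ?thesis"
    then have "bform g gp = 0" if "g \<in> Domain S" for g
      using that by (auto simp: bform_Domain)
    then have "gp \<in> Domain S" by (rule max[OF gpm_simps(1)])
    then show False using sym[of gp gp] by simp
  qed
  then obtain s where s: "s \<in> Domain S" "s \<notin> Domain A" by blast
  have sp: "s \<in> Hp" by (rule S'(2)[OF s(1)])
  define \<alpha> \<beta> where "\<alpha> = bform s gp" and "\<beta> = bform s gm"
  have \<alpha>\<beta>: "\<alpha> * cnj \<alpha> = \<beta> * cnj \<beta>"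
    using bform_expand[OF sp sp] sym[OF s(1) s(1)] by (simp add: \<alpha>_def \<beta>_def)
  have "\<alpha> \<noteq> 0 \<or> \<beta> \<noteq> 0" using s(2) sp by (simp add: Domain_A_iff \<alpha>_def \<beta>_def)
  then have \<alpha>: "\<alpha> \<noteq> 0" using \<alpha>\<beta> by auto
  have zero: "bform f gp * cnj \<alpha> = bform f gm * cnj \<beta>" if "f \<in> Hp" "bform f s = 0" for f
    using bform_expand[OF that(1) sp] that(2) by (simp add: \<alpha>_def \<beta>_def)
  have "f \<in> Domain S" if f: "f \<in> Hp" "bform f s = 0" for f
  proof (rule max[OF f(1)])
    fix g assume g: "g \<in> Domain S"
    then have gp: "g \<in> Hp" "bform g s = 0" using S' sym s(1) by auto
    \<comment> \<open>Both \<open>f\<close> and \<open>g\<close> have coordinates proportional to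
      those of \<open>s\<close>; multiplying the two relations and cancelling the common modulus of
      \<open>\<alpha>\<close> and \<open>\<beta>\<close> makes \<open>bform g f\<close>
      vanish.\<close>
    have "(\<alpha> * cnj \<alpha>) * (bform g gp * cnj (bform f gp)) = (bform g gp * cnj \<alpha>) * cnj (bform f gp * cnj \<alpha>)"
      by simp
    also have "\<dots> = (\<beta> * cnj \<beta>) * (bform g gm * cnj (bform f gm))"
      unfolding zero[OF f] zero[OF gp] by simp
    finally have "bform g gp * cnj (bform f gp) = bform g gm * cnj (bform f gm)"
      using \<alpha> unfolding \<alpha>\<beta>[symmetric] by simp
    then show "bform g f = 0" using bform_expand[OF gp(1) f(1)] by simp
  qed
  then show ?thesis using that[of s] sp S' sym s(1) by blast
qed

end

text \<open>
  The real part of the state operator agrees with \<open>A*\<close> on the domain of the quasi-kernel, a hyperplane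
  in the positive space. As \<open>T\<close> is not symmetric, its domain contains some \<open>f1\<close> off this hyperplane,
  and there the difference is a multiple of the channel vector; hence so it is everywhere.
\<close>

lemma L_system_boundary_triple:
  fixes \<Theta> :: "'h::complex_hilbert lsystem"
  assumes "L_system \<Theta>"
  obtains G0 G1 where "boundary_triple (sym_op \<Theta>) G0 G1"
    "\<And>f. f \<in> plus_space (sym_op \<Theta>) \<Longrightarrow>
      state_op \<Theta> f = boundary_triple.triple_state (sym_op \<Theta>) G0 G1 f"
    "channel \<Theta> = boundary_triple.triple_channel (sym_op \<Theta>) G1"
proof -
  define A T X K where "A = sym_op \<Theta>" and "T = main_op \<Theta>" and "X = state_op \<Theta>" and "K = channel \<Theta>"
  have L: "admissible_symmetric A" "main_operator A T" "star_extension A T X" "bounded_C_minus A K"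
    and im: "\<And>f. f \<in> plus_space A \<Longrightarrow> im_pm A X f = K (adj_K K f)"
    using assms by (auto simp: L_system_def A_def T_def X_def K_def)
  interpret symmetric_1_1 A by unfold_locales (rule L(1))
  have K_scale: "K c g = c * K 1 g" for c g
    using L(4) unfolding bounded_C_minus_def by (metis mult.right_neutral)
  have K1: "K 1 \<in> minus_space A" using L(4) by (simp add: bounded_C_minus_def)
  have X_minus: "X f \<in> minus_space A" if "f \<in> Hp" for f
    using L(3) that by (simp add: star_extension_def bounded_plus_minus_def)
  have X_add: "X (f + g) k = X f k + X g k" if "f \<in> Hp" "g \<in> Hp" for f g k
    using L(3) that by (simp add: star_extension_def bounded_plus_minus_def)
  have X_scale: "X (c *\<^sub>C f) k = c * X f k" if "f \<in> Hp" for c f k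
    using L(3) that by (simp add: star_extension_def bounded_plus_minus_def)
  define G1 where "G1 f = cnj (K 1 f)" for f
  have G1_add: "G1 (f + g) = G1 f + G1 g" if "f \<in> Hp" "g \<in> Hp" for f g
    using K1 that by (simp add: G1_def minus_space_def)
  have G1_scale: "G1 (c *\<^sub>C f) = c * G1 f" if "f \<in> Hp" for c f
    using K1 that by (simp add: G1_def minus_space_def)
  define R where "R = re_pm A X"
  define S where "S = quasi_kernel A R"
  have imX: "(X f g - adj_pm A X f g) / (2 * \<i>) = G1 f * cnj (G1 g)" if "f \<in> Hp" for f g
    using fun_cong[OF im[OF that], of g] K_scale[of "adj_K K f" g] by (simp add: im_pm_def adj_K_def G1_def)
  have X_R: "X f g = R f g + \<i> * G1 f * cnj (G1 g)" if "f \<in> Hp" for f g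
  proof -
    have "X f g = (X f g + adj_pm A X f g) / 2 + \<i> * ((X f g - adj_pm A X f g) / (2 * \<i>))"
      by (simp add: field_simps)
    then show ?thesis unfolding imX[OF that] R_def re_pm_def by (simp only: mult.assoc)
  qed
  have adj_R: "adj_pm A X f g = R f g - \<i> * G1 f * cnj (G1 g)" if "f \<in> Hp" for f g
  proof -
    have "adj_pm A X f g = (X f g + adj_pm A X f g) / 2 - \<i> * ((X f g - adj_pm A X f g) / (2 * \<i>))"
      by (simp add: field_simps)
    then show ?thesis unfolding imX[OF that] R_def re_pm_def by (simp only: mult.assoc)
  qed
  have R_sym: "R f g = cnj (R g f)" if "f \<in> Hp" "g \<in> Hp" for f g
    using that by (simp add: R_def re_pm_def adj_pm_def)
  have R_add: "R (f + g) k = R f k + R g k" if "f \<in> Hp" "g \<in> Hp" for f g k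
    using X_R[of "f + g" k] X_R[of f k] X_R[of g k] X_add[of f g k] G1_add[of f g] that
    by (simp add: algebra_simps)
  have R_scale: "R (c *\<^sub>C f) k = c * R f k" if "f \<in> Hp" for c f k
    using X_R[of "c *\<^sub>C f" k] X_R[of f k] X_scale[of f c k] G1_scale[of f c] that
    by (simp add: algebra_simps)
  have AT: "A \<subseteq> T" and TA: "T \<subseteq> adjoint_op A" and nsym: "\<not> symmetric_op T"
    using L(2) by (auto simp: main_operator_def)
  have XT: "X f = embed A h" if "(f, h) \<in> T" for f h
    using L(3) that by (auto simp: star_extension_def extends_to_pm_def)
  have XT': "adj_pm A X f = embed A h" if "(f, h) \<in> adjoint_op T" for f h
    using L(3) that by (auto simp: star_extension_def extends_to_pm_def)
  have A_T': "A \<subseteq> adjoint_op T" and sa: "self_adjoint S"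
    using L(3) by (auto simp: star_extension_def S_def R_def)
  \<comment> \<open>On \<open>Domain A\<close> both the state operator and its adjoint act as
    \<open>A\<close>, so the imaginary part, whose diagonal value is the squared modulus of
    \<open>G1 f\<close>, vanishes.\<close>
  have G1_A: "G1 f = 0" and R_A: "R f = embed A (Astar f)" if f: "f \<in> Domain A" for f
  proof -
    have fp: "f \<in> Hp" and fA: "(f, Astar f) \<in> A"
      using f A_iff by (auto intro: Domain_A_subset)
    have *: "X f = embed A (Astar f)" "adj_pm A X f = embed A (Astar f)"
      using XT[OF subsetD[OF AT fA]] XT'[OF subsetD[OF A_T' fA]] .
    show "G1 f = 0" using imX[OF fp, of f] * by simp
    show "R f = embed A (Astar f)" using * by (simp add: R_def re_pm_def fun_eq_iff)
  qed
  have AS: "A \<subseteq> S"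
    using R_A A_iff by (auto simp: S_def quasi_kernel_def intro: Domain_A_subset)
  have adjS: "adjoint_op S = S" using sa by (simp add: self_adjoint_def)
  have SA: "S \<subseteq> adjoint_op A" using adjoint_op_antimono[OF AS] adjS by simp
  obtain s where s: "s \<in> Hp" "\<And>f. f \<in> Domain S \<longleftrightarrow> f \<in> Hp \<and> bform f s = 0"
    using self_adjoint_extension_boundary[OF sa AS] by metis
  have R_S: "R f g = cinner (Astar f) g" if fS: "f \<in> Domain S" and gp: "g \<in> Hp" for f g
  proof -
    obtain h where h: "(f, h) \<in> S" using fS by blast
    then have "h = Astar f" using SA adjoint_iff by blast
    then show ?thesis using h gp by (simp add: S_def quasi_kernel_def embed_def)
  qed
  have "\<exists>f\<in>Domain T. G1 f \<noteq> 0"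
  proof (rule ccontr)
    assume no: "\<not> ?thesis"
    have "T \<subseteq> S"
    proof (clarify)
      fix f h assume fh: "(f, h) \<in> T"
      then have fp: "f \<in> Hp" and "G1 f = 0" using no TA adjoint_iff by blast+
      then have "R f = X f" using X_R by (simp add: fun_eq_iff)
      then show "(f, h) \<in> S" using XT[OF fh] fp by (simp add: S_def quasi_kernel_def)
    qed
    then have "T \<subseteq> adjoint_op T" using adjoint_op_antimono[of T S] adjS by blast
    then show False using nsym by (simp add: symmetric_op_def)
  qed
  then obtain f1 h1 where f1: "(f1, h1) \<in> T" and G1f1: "G1 f1 \<noteq> 0" by blast
  have f1p: "f1 \<in> Hp" and h1: "h1 = Astar f1" using TA f1 adjoint_iff by blast+
  have D1: "R f1 g = cinner (Astar f1) g - \<i> * G1 f1 * cnj (G1 g)" if "g \<in> Hp" for g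
    using X_R[OF f1p, of g] XT[OF f1] that by (simp add: embed_def h1)
  have bf1: "bform f1 s \<noteq> 0"
  proof
    assume "bform f1 s = 0"
    then have "f1 \<in> Domain S" using s(2) f1p by simp
    from R_S[OF this f1p] D1[OF f1p] G1f1 show False by simp
  qed
  \<comment> \<open>The constant is fixed by \<open>G0 f1 + i G1 f1 = 0\<close>, the boundary
    condition expected on \<open>Domain T\<close>; the kernel on the positive space is
    \<open>Domain S\<close>.\<close>
  define G0 where "G0 f = - \<i> * G1 f1 / bform f1 s * bform f s" for f
  have R_eq: "R f g = cinner (Astar f) g + G0 f * cnj (G1 g)" if fp: "f \<in> Hp" and gp: "g \<in> Hp" for f g
  proof -
    define y where "y = bform f s / bform f1 s"
    define u where "u = f - y *\<^sub>C f1"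
    have up: "u \<in> Hp" using fp f1p by (simp add: u_def)
    have "bform u s = 0" using fp f1p bf1 by (simp add: u_def bform_linear y_def)
    then have uS: "u \<in> Domain S" using s(2) up by simp
    have "f = u + y *\<^sub>C f1" by (simp add: u_def)
    then have "R f g = R (u + y *\<^sub>C f1) g" "cinner (Astar f) g = cinner (Astar (u + y *\<^sub>C f1)) g" by metis+
    then show ?thesis
      using R_add[OF up, of "y *\<^sub>C f1" g] R_scale[OF f1p, of y g] R_S[OF uS gp] D1[OF gp] up f1p
      by (simp add: cinner_distribs G0_def y_def algebra_simps)
  qed
  have bt: "boundary_triple A G0 G1"
  proof unfold_locales
    fix f g assume fg: "f \<in> Hp" "g \<in> Hp"
    \<comment> \<open>Hermitian symmetry of the real part, written out with \<open>R_eq\<close>, is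
      precisely the Green identity.\<close>
    have "cinner (Astar f) g + G0 f * cnj (G1 g) = cnj (cinner (Astar g) f + G0 g * cnj (G1 f))"
      using R_sym[OF fg] R_eq[OF fg] R_eq[OF fg(2,1)] by simp
    then show "bform f g = cnj (G0 g) * G1 f - G0 f * cnj (G1 g)"
      using cinner_commute[of f "Astar g"] by (simp add: bform_def algebra_simps)
  qed (simp_all add: G0_def bform_linear G1_add G1_scale algebra_simps add_divide_distrib)
  interpret boundary_triple A G0 G1 by (rule bt)
  have outside: "X f g = 0" if "f \<in> Hp" "g \<notin> Hp" for f g
    using X_minus[OF that(1)] that(2) by (simp add: minus_space_def)
  have outside_K: "K c g = 0" if "g \<notin> Hp" for c g
    using K_scale[of c g] K1 that by (simp add: minus_space_def)
  have "X f = triple_state f" if f: "f \<in> Hp" for f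
    using X_R[OF f] R_eq[OF f] outside[OF f]
    by (auto simp: triple_state_def minus_vec_def fun_eq_iff algebra_simps)
  moreover have "K = triple_channel"
  proof (intro ext)
    fix c g
    show "K c g = triple_channel c g"
      using K_scale[of c g] outside_K[of g c] by (simp add: triple_channel_def minus_vec_def G1_def)
  qed
  ultimately show ?thesis using that[of G0 G1] bt by (simp add: A_def X_def K_def)
qed

section \<open>The von Neumann parameters\<close>

context boundary_triple
begin

text \<open>\<open>m\<close> is the value at \<open>i\<close> of the Weyl function
  \<open>G1 / G0\<close>, with the conjugate value at \<open>-i\<close>; the product form needs no
  division.\<close>

definition weyl_value :: "complex \<Rightarrow> bool" where
  "weyl_value m \<longleftrightarrow> (\<forall>f \<in> N \<i>. G1 f = m * G0 f) \<and> (\<forall>f \<in> N (-\<i>). G1 f = cnj m * G0 f)"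

text \<open>For a unit deficiency vector the Green identity of \<open>f\<close> with itself reads
  \<open>2 i = (m - cnj m) |G0 f|^2\<close>, up to a common sign at \<open>-i\<close>.\<close>

lemma G0_deficiency:
  assumes "weyl_value m" "f \<in> N \<i> \<union> N (-\<i>)" "norm f = 1"
  shows "(cmod (G0 f))\<^sup>2 * Im m = 1"
proof -
  have green': "2 * \<i> * complex_of_real (Im m * (cmod (G0 f))\<^sup>2) = 2 * \<i>"
  proof -
    have dm: "2 * \<i> * complex_of_real (Im m) = m - cnj m" by (simp add: complex_eq_iff)
    consider "f \<in> N \<i>" | "f \<in> N (-\<i>)" using assms(2) by blast
    then show ?thesis
    proof cases
      case 1
      then have f: "f \<in> Hp" "G1 f = m * G0 f" using assms(1) by (auto simp: N_iff weyl_value_def)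
      have "bform f f = 2 * \<i>" using bform_N[OF 1 1] assms(3) by (simp add: cinner_self)
      moreover have "bform f f = (m - cnj m) * (G0 f * cnj (G0 f))"
        by (simp add: green f algebra_simps)
      ultimately show ?thesis
        unfolding dm[symmetric] complex_norm_square[symmetric] by (simp add: mult.assoc)
    next
      case 2
      then have f: "f \<in> Hp" "G1 f = cnj m * G0 f" using assms(1) by (auto simp: N_iff weyl_value_def)
      have "bform f f = - 2 * \<i>" using bform_N[OF 2 2] assms(3) by (simp add: cinner_self)
      moreover have "bform f f = - ((m - cnj m) * (G0 f * cnj (G0 f)))"
        by (simp add: green f algebra_simps)
      ultimately show ?thesis
        unfolding dm[symmetric] complex_norm_square[symmetric] by (simp add: mult.assoc)
    qed
  qed
  then have "Im m * (cmod (G0 f))\<^sup>2 = 1" by (simp add: complex_eq_iff del: of_real_power of_real_mult)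
  then show ?thesis by (simp add: mult.commute)
qed

lemma G0_deficiency_pair:
  assumes "weyl_value m" "0 < Im m" "x \<in> N \<i>" "y \<in> N (-\<i>)" "norm x = 1" "norm y = 1"
  shows "cmod (G0 x) = cmod (G0 y)" "G0 y \<noteq> 0"
proof -
  have *: "(cmod (G0 x))\<^sup>2 * Im m = 1" "(cmod (G0 y))\<^sup>2 * Im m = 1"
    using G0_deficiency[OF assms(1)] assms(3-) by simp_all
  then have "(cmod (G0 x))\<^sup>2 * Im m = (cmod (G0 y))\<^sup>2 * Im m" by simp
  then have "(cmod (G0 x))\<^sup>2 = (cmod (G0 y))\<^sup>2" using assms(2) by (subst (asm) mult_right_cancel) auto
  then show "cmod (G0 x) = cmod (G0 y)" by (simp add: power2_eq_iff_nonneg)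
  show "G0 y \<noteq> 0" using *(2) by auto
qed

lemma normalized_pair_bker:
  assumes m: "weyl_value m" and g: "gp \<in> N \<i>" "gm \<in> N (-\<i>)" "norm gp = 1" "norm gm = 1"
  shows "normalized_pair A (bker 1 \<i>) gp gm k \<longleftrightarrow> 0 \<le> k \<and> k < 1
    \<and> (1 + \<i> * m) * G0 gp = complex_of_real k * ((1 + \<i> * cnj m) * G0 gm)"
proof -
  have gH: "gp \<in> Hp" "gm \<in> Hp" using g by (auto simp: N_iff)
  have "G1 gp = m * G0 gp" "G1 gm = cnj m * G0 gm" using m g by (auto simp: weyl_value_def)
  then have "gp - complex_of_real k *\<^sub>C gm \<in> Domain (bker 1 \<i>)
      \<longleftrightarrow> (1 + \<i> * m) * G0 gp - complex_of_real k * ((1 + \<i> * cnj m) * G0 gm) = 0"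
    using gH by (simp add: Domain_bker algebra_simps)
  then show ?thesis using g by (simp add: normalized_pair_def)
qed

text \<open>The conditions on a normalized pair involve only \<open>m\<close> and the ratio of
  \<open>G0 gp\<close> to \<open>G0 gm\<close>, which has modulus one. Taking moduli determines
  \<open>\<kappa>\<close>; since \<open>\<kappa>\<close> is nonzero, the ratio itself is then
  determined and gives the parameter of the kernel of \<open>G0\<close>.\<close>

lemma vN_parameters:
  assumes m: "weyl_value m" and Im: "0 < Im m" and ne: "1 + \<i> * m \<noteq> 0"
  defines "\<kappa> \<equiv> cmod (1 + \<i> * m) / cmod (1 + \<i> * cnj m)"
  shows "vN_parameter A (bker 1 \<i>) k \<longleftrightarrow> k = \<kappa>"
    and "vN_parameter_sa A (bker 1 \<i>) (bker 1 0) u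
      \<longleftrightarrow> u = - complex_of_real \<kappa> * (1 + \<i> * cnj m) / (1 + \<i> * m)"
proof -
  define w v where "w = 1 + \<i> * m" and "v = 1 + \<i> * cnj m"
  define U where "U = - complex_of_real \<kappa> * v / w"
  have w: "w \<noteq> 0" using ne by (simp add: w_def)
  \<comment> \<open>Both numbers have imaginary part \<open>Re m\<close>, while their real parts are
    \<open>1 - Im m\<close> and \<open>1 + Im m\<close>.\<close>
  have "(cmod w)\<^sup>2 < (cmod v)\<^sup>2"
    unfolding cmod_power2 using Im by (simp add: w_def v_def power2_eq_square algebra_simps)
  then have wv: "cmod w < cmod v" by (rule power2_less_imp_less) simp
  then have v: "v \<noteq> 0" by auto
  have \<kappa>: "0 < \<kappa>" "\<kappa> < 1" using w v wv by (simp_all add: \<kappa>_def w_def[symmetric] v_def[symmetric])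
  have pair: "normalized_pair A (bker 1 \<i>) gp gm k \<longleftrightarrow> gp \<in> N \<i> \<and> gm \<in> N (-\<i>)
    \<and> norm gp = 1 \<and> norm gm = 1 \<and> k = \<kappa> \<and> w * G0 gp = complex_of_real \<kappa> * (v * G0 gm)" for gp gm k
  proof (cases "gp \<in> N \<i> \<and> gm \<in> N (-\<i>) \<and> norm gp = 1 \<and> norm gm = 1")
    case True
    then have pq: "cmod (G0 gp) = cmod (G0 gm)" "G0 gm \<noteq> 0"
      using G0_deficiency_pair[OF m Im, of gp gm] by auto
    have "k = \<kappa>" if "0 \<le> k" "w * G0 gp = complex_of_real k * (v * G0 gm)"
    proof -
      have "cmod w * cmod (G0 gp) = k * (cmod v * cmod (G0 gm))"
        using arg_cong[OF that(2), of cmod] that(1) by (simp add: norm_mult)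
      then have "cmod w = k * cmod v" using pq by simp
      then show ?thesis using v by (simp add: \<kappa>_def w_def v_def)
    qed
    then show ?thesis
      using normalized_pair_bker[OF m, of gp gm k] True \<kappa> by (auto simp: w_def v_def)
  qed (auto simp: normalized_pair_def)
  obtain gp gm where "deficiency_pair A gp gm" by (rule deficiency_pair_exists)
  then interpret deficiency_pair A gp gm .
  note pq = G0_deficiency_pair[OF m Im gp gm norm_gp norm_gm]
  \<comment> \<open>The phase by which \<open>gm\<close> must be rotated so that the parameter
    becomes the positive number \<open>\<kappa>\<close>.\<close>
  define e where "e = w * G0 gp / (complex_of_real \<kappa> * (v * G0 gm))"
  have e: "cmod e = 1"
    using pq v w by (simp add: e_def norm_mult norm_divide \<kappa>_def w_def[symmetric] v_def[symmetric])
  have ex: "normalized_pair A (bker 1 \<i>) gp (e *\<^sub>C gm) \<kappa>"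
    unfolding pair using gp gm norm_gp norm_gm e pq v w \<kappa> complex_vector.subspace_scale[OF N_subspace gm]
    by (simp add: norm_scaleC e_def)
  show "vN_parameter A (bker 1 \<i>) k \<longleftrightarrow> k = \<kappa>"
    using ex pair unfolding vN_parameter_def by blast
  have sa: "cmod u = 1 \<and> x + u *\<^sub>C y \<in> Domain (bker 1 0) \<longleftrightarrow> u = U"
    if "normalized_pair A (bker 1 \<i>) x y k" for x y k u
  proof -
    have xy: "x \<in> N \<i>" "y \<in> N (-\<i>)" "norm x = 1" "norm y = 1"
      "w * G0 x = complex_of_real \<kappa> * (v * G0 y)"
      using that unfolding pair by auto
    note pq = G0_deficiency_pair[OF m Im xy(1-4)]
    have U: "U * G0 y = - G0 x" using xy(5) w by (simp add: U_def field_simps)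
    then have "cmod U * cmod (G0 y) = cmod (G0 x)" by (metis norm_minus_cancel norm_mult)
    then have U1: "cmod U = 1" using pq by simp
    have "x + u *\<^sub>C y \<in> Domain (bker 1 0) \<longleftrightarrow> G0 x + u * G0 y = 0"
      using xy by (simp add: Domain_bker N_iff)
    also have "\<dots> \<longleftrightarrow> (u - U) * G0 y = 0" using U by (simp add: algebra_simps)
    finally show ?thesis using U1 pq(2) by auto
  qed
  have "vN_parameter_sa A (bker 1 \<i>) (bker 1 0) u \<longleftrightarrow> u = U"
    unfolding vN_parameter_sa_def using sa ex by blast
  then show "vN_parameter_sa A (bker 1 \<i>) (bker 1 0) u
      \<longleftrightarrow> u = - complex_of_real \<kappa> * (1 + \<i> * cnj m) / (1 + \<i> * m)"
    by (simp add: U_def w_def v_def)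
qed

text \<open>An eigenvector at nonreal \<open>z\<close> has \<open>G0 f\<close> nonzero, since the
  kernel of \<open>G0\<close> is the domain of a self-adjoint operator; rescaled to
  \<open>G0 f = 1\<close> it computes the impedance.\<close>

lemma weyl_value_impedance:
  assumes \<Theta>: "sym_op \<Theta> = A" "\<And>f. f \<in> Hp \<Longrightarrow> state_op \<Theta> f = triple_state f"
      "channel \<Theta> = triple_channel"
    and imp: "impedance \<Theta> \<i> = m" "impedance \<Theta> (-\<i>) = cnj m"
  shows "weyl_value m"
proof -
  have "G1 f = impedance \<Theta> z * G0 f" if f: "f \<in> N z" and z: "Im z \<noteq> 0" for f z
  proof (cases "f = 0")
    case False
    have inj: "u = 0" if "(u, z *\<^sub>C u) \<in> bker 1 0" for u
      using self_adjoint_eigenvalue[OF bker_self_adjoint that z] .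
    have fp: "f \<in> Hp" "Astar f = z *\<^sub>C f" using f by (auto simp: N_iff)
    have p: "G0 f \<noteq> 0"
    proof
      assume "G0 f = 0"
      then have "(f, z *\<^sub>C f) \<in> bker 1 0" using fp by (simp add: bker_iff)
      with inj False show False by blast
    qed
    have "inverse (G0 f) *\<^sub>C f \<in> N z" "G0 (inverse (G0 f) *\<^sub>C f) = 1"
      using complex_vector.subspace_scale[OF N_subspace f] fp p by simp_all
    from impedance_triple[OF \<Theta> this inj] show ?thesis using fp p by (simp add: field_simps)
  qed simp
  from this[of _ \<i>] this[of _ "-\<i>"] show ?thesis unfolding weyl_value_def imp by simp
qed

end

section \<open>Values of the class at \<open>i\<close> and \<open>-i\<close>, and the closed form of
  the parameter\<close>

lemma class_M_impedance:
  assumes "class_M \<kappa> V"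
  defines "a \<equiv> (1 - \<kappa>) / (1 + \<kappa>)"
  shows "V \<i> = \<i> * complex_of_real a" "V (-\<i>) = - \<i> * complex_of_real a" "0 < a"
proof -
  obtain \<mu> :: "real measure" where \<kappa>: "0 \<le> \<kappa>" "\<kappa> < 1" and \<mu>: "sets \<mu> = sets borel"
    and I: "(\<integral>\<^sup>+ t. ennreal (1 / (1 + t\<^sup>2)) \<partial>\<mu>) = ennreal a"
    and V: "\<And>z. Im z \<noteq> 0 \<Longrightarrow>
      V z = (LINT t|\<mu>. 1 / (complex_of_real t - z) - complex_of_real (t / (1 + t\<^sup>2)))"
    using assms(1) unfolding class_M_def a_def by blast
  show a: "0 < a" using \<kappa> by (simp add: a_def)
  have meas: "(\<lambda>t. 1 / (1 + t\<^sup>2)) \<in> borel_measurable \<mu>"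
    unfolding measurable_cong_sets[OF \<mu> refl] by measurable
  have int: "integrable \<mu> (\<lambda>t. 1 / (1 + t\<^sup>2))" and L: "(LINT t|\<mu>. 1 / (1 + t\<^sup>2)) = a"
    using nn_integral_eq_integrable[OF meas, of a] I a by (auto simp: add_nonneg_nonneg)
  \<comment> \<open>At \<open>z = i\<close> and \<open>z = -i\<close> the integrand collapses to
    \<open>z / (1 + t^2)\<close>, whose integral is the normalization constant of the class times
    \<open>z\<close>.\<close>
  have "1 / (complex_of_real t - z) - complex_of_real (t / (1 + t\<^sup>2)) = z * complex_of_real (1 / (1 + t\<^sup>2))"
    if "z\<^sup>2 = -1" for t z
  proof -
    have "(complex_of_real t - z) * (complex_of_real t + z) = complex_of_real (1 + t\<^sup>2)"
      using that by (simp add: algebra_simps power2_eq_square)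
    moreover have "complex_of_real (1 + t\<^sup>2) \<noteq> 0"
      by (metis of_real_eq_0_iff add_pos_nonneg less_irrefl zero_le_power2 zero_less_one)
    ultimately have "1 / (complex_of_real t - z) = (complex_of_real t + z) / complex_of_real (1 + t\<^sup>2)"
      by (metis frac_eq_eq mult.commute mult_1 mult_zero_left)
    then show ?thesis by (simp add: add_divide_distrib)
  qed
  note eq = this
  have "V z = z * complex_of_real a" if "z\<^sup>2 = -1" "Im z \<noteq> 0" for z
    unfolding V[OF that(2)] eq[OF that(1)] using int by (simp add: L[symmetric] del: of_real_divide)
  from this[of \<i>] this[of "-\<i>"] show "V \<i> = \<i> * complex_of_real a" "V (-\<i>) = - \<i> * complex_of_real a"
    by simp_all
qed

text \<open>The right-hand side is \<open>|1 + i m| / |1 + i cnj m|\<close> for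
  \<open>m = Q + i a\<close>, the quotient found in \<open>vN_parameters\<close>. The radicand on
  the left factors as the product of the two radicands on the right.\<close>

lemma kappa_formula:
  fixes a Q :: real
  assumes a: "0 < a" and Q: "Q \<noteq> 0"
  defines "b \<equiv> Q\<^sup>2 + a\<^sup>2 - 1"
  shows "((b - 2 * Q\<^sup>2 - sqrt (b\<^sup>2 + 4 * Q\<^sup>2))\<^sup>2 - a * (b - sqrt (b\<^sup>2 + 4 * Q\<^sup>2))\<^sup>2
         + 4 * Q\<^sup>2 * a * (a - 1))
      / ((b - 2 * Q\<^sup>2 - sqrt (b\<^sup>2 + 4 * Q\<^sup>2))\<^sup>2 + a * (b - sqrt (b\<^sup>2 + 4 * Q\<^sup>2))\<^sup>2
         + 4 * Q\<^sup>2 * a * (a + 1))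
    = sqrt ((1 - a)\<^sup>2 + Q\<^sup>2) / sqrt ((1 + a)\<^sup>2 + Q\<^sup>2)"
proof -
  define D m n where "D = sqrt (b\<^sup>2 + 4 * Q\<^sup>2)" and "m = (1 - a)\<^sup>2 + Q\<^sup>2" and "n = (1 + a)\<^sup>2 + Q\<^sup>2"
  define N E where "N = (b - 2 * Q\<^sup>2 - D)\<^sup>2 - a * (b - D)\<^sup>2 + 4 * Q\<^sup>2 * a * (a - 1)"
    and "E = (b - 2 * Q\<^sup>2 - D)\<^sup>2 + a * (b - D)\<^sup>2 + 4 * Q\<^sup>2 * a * (a + 1)"
  have mn: "b\<^sup>2 + 4 * Q\<^sup>2 = m * n"
    by (simp add: b_def m_def n_def power2_eq_square algebra_simps)
  have n: "0 < n" using Q by (simp add: n_def add_nonneg_pos)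
  have E: "0 < E"
    using a Q by (auto simp: E_def intro!: add_nonneg_pos mult_pos_pos)
  have D2: "D\<^sup>2 = b\<^sup>2 + 4 * Q\<^sup>2" by (simp add: D_def)
  \<comment> \<open>As a polynomial in \<open>D\<close>, this difference has a factor that vanishes
    by the definition of \<open>D\<close>.\<close>
  have "N * n - E * D = (D\<^sup>2 - b\<^sup>2 - 4 * Q\<^sup>2) * ((a - 1) * ((a + 1)\<^sup>2 + Q\<^sup>2) - (a + 1) * D)"
    unfolding N_def E_def n_def b_def by algebra
  then have "N / E = D / n" using n E by (simp add: D2 field_simps)
  also have "D = sqrt m * sqrt n" by (simp add: D_def mn real_sqrt_mult)
  also have "\<dots> / n = sqrt m / sqrt n" using n by (simp add: field_simps)
  finally show ?thesis by (simp add: N_def E_def D_def m_def n_def)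
qed

theorem theorem36:
  fixes \<Theta>\<^sub>0 :: "'h::complex_hilbert lsystem"
    and \<kappa>\<^sub>0 Q a b \<kappa> :: real
    and U :: complex
  assumes "a = (1 - \<kappa>\<^sub>0) / (1 + \<kappa>\<^sub>0)"
    and "b = Q\<^sup>2 + a\<^sup>2 - 1"
    and "\<kappa> =
      ((b - 2 * Q\<^sup>2 - sqrt (b\<^sup>2 + 4 * Q\<^sup>2))\<^sup>2 - a * (b - sqrt (b\<^sup>2 + 4 * Q\<^sup>2))\<^sup>2
         + 4 * Q\<^sup>2 * a * (a - 1))
      / ((b - 2 * Q\<^sup>2 - sqrt (b\<^sup>2 + 4 * Q\<^sup>2))\<^sup>2 + a * (b - sqrt (b\<^sup>2 + 4 * Q\<^sup>2))\<^sup>2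
         + 4 * Q\<^sup>2 * a * (a + 1))"
    and "U =
      ((complex_of_real a + complex_of_real Q * \<i>) * (1 - (complex_of_real \<kappa>)\<^sup>2)
         - 1 - (complex_of_real \<kappa>)\<^sup>2) / (2 * complex_of_real \<kappa>)"
    and "L_system \<Theta>\<^sub>0"
    and "class_M \<kappa>\<^sub>0 (impedance \<Theta>\<^sub>0)"
    and "Q \<noteq> 0"
  shows "\<exists>\<Theta> :: 'h lsystem. L_system \<Theta>
    \<and> sym_op \<Theta> = sym_op \<Theta>\<^sub>0
    \<and> (\<forall>z \<in> resolvent_set (re_quasi_kernel \<Theta>) \<inter> resolvent_set (re_quasi_kernel \<Theta>\<^sub>0).
          impedance \<Theta> z = complex_of_real Q + impedance \<Theta>\<^sub>0 z)
    \<and> (\<forall>k. vN_parameter (sym_op \<Theta>) (main_op \<Theta>) k \<longleftrightarrow> k = \<kappa>)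
    \<and> (\<forall>u. vN_parameter_sa (sym_op \<Theta>) (main_op \<Theta>) (re_quasi_kernel \<Theta>) u \<longleftrightarrow> u = U)"
proof -
  have V: "impedance \<Theta>\<^sub>0 \<i> = \<i> * complex_of_real a" "impedance \<Theta>\<^sub>0 (-\<i>) = - \<i> * complex_of_real a"
    and a: "0 < a"
    using class_M_impedance[OF assms(6)] unfolding assms(1) by simp_all
  obtain G0 G1 where bt: "boundary_triple (sym_op \<Theta>\<^sub>0) G0 G1"
    and \<Theta>0: "\<And>f. f \<in> plus_space (sym_op \<Theta>\<^sub>0) \<Longrightarrow>
      state_op \<Theta>\<^sub>0 f = boundary_triple.triple_state (sym_op \<Theta>\<^sub>0) G0 G1 f"
    "channel \<Theta>\<^sub>0 = boundary_triple.triple_channel (sym_op \<Theta>\<^sub>0) G1"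
    using L_system_boundary_triple[OF assms(5)] by blast
  interpret B: boundary_triple "sym_op \<Theta>\<^sub>0" G0 G1 by (rule bt)
  interpret BQ: boundary_triple "sym_op \<Theta>\<^sub>0" G0 "\<lambda>f. G1 f + complex_of_real Q * G0 f"
    by (rule B.boundary_triple_shift)
  let ?\<Theta> = BQ.triple_system
  define m where "m = complex_of_real Q + \<i> * complex_of_real a"
  \<comment> \<open>\<open>G0\<close> is unchanged by the shift, so both systems have the same
    quasi-kernel and the impedances are compared on one resolvent set.\<close>
  have ker: "BQ.bker 1 0 = B.bker 1 0" by (simp add: BQ.bker_def B.bker_def)
  have qk0: "re_quasi_kernel \<Theta>\<^sub>0 = B.bker 1 0"
    unfolding re_quasi_kernel_def by (rule B.quasi_kernel_triple[OF \<Theta>0(1)])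
  have qk: "re_quasi_kernel ?\<Theta> = BQ.bker 1 0"
    by (simp add: re_quasi_kernel_def BQ.quasi_kernel_triple)
  have imp: "impedance ?\<Theta> z = complex_of_real Q + impedance \<Theta>\<^sub>0 z" if z: "z \<in> resolvent_set (B.bker 1 0)" for z
  proof -
    obtain f where f: "f \<in> B.N z" "G0 f = 1" and inj: "\<And>f. (f, z *\<^sub>C f) \<in> B.bker 1 0 \<Longrightarrow> f = 0"
      using B.resolvent_set_triple[OF z] by metis
    have "impedance \<Theta>\<^sub>0 z = G1 f" by (rule B.impedance_triple[OF refl \<Theta>0 f inj])
    moreover have "impedance ?\<Theta> z = G1 f + complex_of_real Q * G0 f"
      using inj by (intro BQ.impedance_triple f) (simp_all add: ker)
    ultimately show ?thesis using f(2) by simp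
  qed
  have "B.weyl_value (\<i> * complex_of_real a)"
    using V by (intro B.weyl_value_impedance[OF refl \<Theta>0]) simp_all
  then have weyl: "BQ.weyl_value m"
    unfolding B.weyl_value_def BQ.weyl_value_def m_def by (simp add: algebra_simps)
  have Im: "0 < Im m" using a by (simp add: m_def)
  define w v where "w = 1 + \<i> * m" and "v = 1 + \<i> * cnj m"
  \<comment> \<open>The real part \<open>1 - a\<close> may vanish; the imaginary part is
    \<open>Q\<close>. This also makes \<open>\<kappa>\<close> nonzero, so the quotient defining
    \<open>U\<close> is a genuine one.\<close>
  have w: "w \<noteq> 0" using assms(7) by (simp add: w_def m_def complex_eq_iff)
  have \<kappa>: "\<kappa> = cmod w / cmod v"
    unfolding assms(3) kappa_formula[OF a assms(7), folded assms(2)]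
    by (simp add: w_def v_def m_def cmod_def)
  have v: "v \<noteq> 0" using a by (simp add: v_def m_def complex_eq_iff)
  have \<kappa>2: "(complex_of_real \<kappa>)\<^sup>2 * (v * cnj v) = w * cnj w"
    unfolding complex_norm_square[symmetric] using v by (simp add: \<kappa> power_divide)
  have \<kappa>0: "complex_of_real \<kappa> \<noteq> 0" using w v by (simp add: \<kappa>)
  \<comment> \<open>These relations eliminate \<open>a\<close> and \<open>Q\<close>, so that the
    formula for \<open>U\<close> becomes an identity between \<open>w\<close>, \<open>v\<close> and
    \<open>\<kappa>\<close>.\<close>
  have av: "complex_of_real a + complex_of_real Q * \<i> = v - 1" and cv: "cnj v = 2 - w"
    and cw: "v - 2 = - cnj w"
    by (simp_all add: w_def v_def m_def complex_eq_iff)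
  have "U * (2 * complex_of_real \<kappa>)
      = (v - 1) * (1 - (complex_of_real \<kappa>)\<^sup>2) - 1 - (complex_of_real \<kappa>)\<^sup>2"
    using assms(4)[unfolded av] \<kappa>0 by (subst (asm) nonzero_eq_divide_eq) simp_all
  then have "U * (2 * complex_of_real \<kappa>) = v - 2 - (complex_of_real \<kappa>)\<^sup>2 * v"
    by (simp add: algebra_simps)
  \<comment> \<open>Multiplying by \<open>w\<close> produces \<open>w * cnj w\<close>, which
    \<open>\<kappa>2\<close> rewrites; then \<open>cnj v + w = 2\<close> leaves a factor
    \<open>2 * \<kappa>\<close> to cancel.\<close>
  then have "U * w * (2 * complex_of_real \<kappa>) = - (w * cnj w) - (complex_of_real \<kappa>)\<^sup>2 * v * w"
    unfolding cw by algebra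
  also have "\<dots> = - ((complex_of_real \<kappa>)\<^sup>2 * v * (cnj v + w))"
    unfolding \<kappa>2[symmetric] by algebra
  also have "\<dots> = (- complex_of_real \<kappa> * v) * (2 * complex_of_real \<kappa>)"
    unfolding cv by (simp add: power2_eq_square)
  finally have "U * w = - complex_of_real \<kappa> * v" using \<kappa>0 by (subst (asm) mult_right_cancel) auto
  then have U: "U = - complex_of_real \<kappa> * v / w" by (rule iffD2[OF nonzero_eq_divide_eq[OF w]])
  show ?thesis
    using BQ.L_system_triple imp BQ.vN_parameters[OF weyl Im w[unfolded w_def]]
    by (intro exI[of _ ?\<Theta>]) (simp add: qk qk0 ker U \<kappa> w_def v_def)
qed

end
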